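(* Let $\mathbf{X}$ be a computably compact Hausdorff represented space admitting a proper computable dyadic subbase. Then there are a surjection $t_\mathbf{X}:\mathbb{T}^\omega\to\mathcal{A}(\mathbf{X})$ and a multivalued map $s_\mathbf{X}:\mathcal{A}(\mathbf{X})\rightrightarrows\mathbb{T}^\omega$ such that: (1) $s_\mathbf{X}$ and $t_\mathbf{X}$ are computable; (2) $t_\mathbf{X}\circ s_\mathbf{X}=\mathrm{id}_{\mathcal{A}(\mathbf{X})}$; (3) if $A\in\mathcal{A}(\mathbf{X})$ is finite, then every $p\in s_\mathbf{X}(A)$ has exactly $|A|$ positions $n$ with $p(n)=\bot$.
   Context: A represented space is a pair $\mathbf{X}=(X,\delta_X)$ with $\delta_X :\subseteq \{0,1\}^\omega \to X$ a partial surjection. A (multivalued) map $f :\subseteq \mathbf{X} \rightrightarrows \mathbf{Y}$ is computable if some computable $F :\subseteq \{0,1\}^\omega \to \{0,1\}^\omega$ satisfies $\delta_Y(F(p)) \in f(\delta_X(p))$ for all $p \in \operatorname{dom}(f\circ\delta_X)$. Sierpiński space $\mathbb{S}=\{\bot,\top\}$ has $\delta_\mathbb{S}(0^\omega)=\bot$, $\delta_\mathbb{S}(p)=\top$ for $p\neq0^\omega$. $\mathcal{O}(\mathbf{X})$: open sets $U$ represented via $\chi_U\in\mathcal{C}(\mathbf{X},\mathbb{S})$ (standard function-space representation); the topology of $\mathbf{X}$ is the final topology of $\delta_X$, and "Hausdorff" refers to it. $\mathcal{A}(\mathbf{X})$: closed sets $A$ represented by an $\mathcal{O}(\mathbf{X})$-name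 of $X\setminus A$. $\mathbf{X}$ is computably compact if $\mathrm{isEmpty}:\mathcal{A}(\mathbf{X})\to\mathbb{S}$ is computable. Plotkin's $\mathbb{T}=\{0,1,\bot\}$ is represented by $\delta_\mathbb{T}(0^\omega)=\bot$, $\delta_\mathbb{T}(p)=0$ if $\min\{n\mid p(n)=1\}$ is even and $1$ if odd; $\mathbb{T}^\omega$ carries the induced product representation $\delta_{\mathbb{T}^\omega}$, and computability of maps into/out of $\mathbb{T}^\omega$ is with respect to $\delta_{\mathbb{T}^\omega}$. A dyadic subbase of $\mathbf{X}$ is a map $S:\mathbb{N}\times\{0,1\}\to\mathcal{O}(\mathbf{X})$, $(n,i)\mapsto S_{n,i}$, whose image is a subbase of the topology of $\mathbf{X}$ and with $S_{n,0}\cap S_{n,1}=\emptyset$. Let $S_{n,\bot}=X\setminus(S_{n,0}\cup S_{n,1})$ and $\varphi_S:X\to\mathbb{T}^\omega$, $\varphi_S(x)(n)=a$ iff $x\in S_{n,a}$. $S$ is computable if $S$ is computable and $\varphi_S$ and its partial inverse are computable. For $p\in\mathbb{T}^\omega$ let $\operatorname{dom}(p)=\{k\mid p(k)\neq\bot\}$, $S(p)=\bigcap_{k\in\operatorname{dom}(p)}S_{k,p(k)}$, $\bar S(p)=\bigcap_{k\in\operatorname{dom}(p)}(X\setminus S_{k,1-p(k)})$; a finite sequence $e$ over $\mathbb{T}$ is identified with $e\bot^\omega$. $S$ is proper if $\mathrm{cl}\,S(e)=\bar S(e)$ for all finite sequences $e$ over $\mathbb{T}$. *)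

theory Defs
  imports "HOL-Analysis.Analysis" "HOL-Library.Nat_Bijection"
begin

section \<open>Computable partial functions on Cantor space\<close>

type_synonym cantor = "nat \<Rightarrow> bool"

text \<open>
  Partial recursive functionals: \<open>\<Phi> p\<close> is a partial function on \<open>nat\<close> that is partial recursive in
  the oracle \<open>p\<close>, uniformly in \<open>p\<close>. Functions of several arguments are coded as unary ones by
  the Cantor pairing \<^const>\<open>prod_encode\<close>, so the pairing projections and the pairing of two functionals
  replace the projections and the \<open>n\<close>-ary composition of Kleene's scheme.
\<close>

inductive partial_recursive :: "(cantor \<Rightarrow> nat \<Rightarrow> nat option) \<Rightarrow> bool" where
  zero: "partial_recursive (\<lambda>p n. Some 0)"
| succ: "partial_recursive (\<lambda>p n. Some (Suc n))"
| left: "partial_recursive (\<lambda>p n. Some (fst (prod_decode n)))"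
| right: "partial_recursive (\<lambda>p n. Some (snd (prod_decode n)))"
| query: "partial_recursive (\<lambda>p n. Some (of_bool (p n)))"
| pair: "partial_recursive F \<Longrightarrow> partial_recursive G \<Longrightarrow>
    partial_recursive
      (\<lambda>p n. Option.bind (F p n) (\<lambda>a. Option.bind (G p n) (\<lambda>b. Some (prod_encode (a, b)))))"
| comp: "partial_recursive F \<Longrightarrow> partial_recursive G \<Longrightarrow>
    partial_recursive (\<lambda>p n. Option.bind (G p n) (F p))"
| prec: "partial_recursive F \<Longrightarrow> partial_recursive G \<Longrightarrow>
    partial_recursive (\<lambda>p n. case prod_decode n of (a, k) \<Rightarrow>
      rec_nat (F p a)
        (\<lambda>i r. Option.bind r (\<lambda>v. G p (prod_encode (a, prod_encode (i, v))))) k)"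
| mu: "partial_recursive F \<Longrightarrow>
    partial_recursive (\<lambda>p n.
      if \<exists>k. F p (prod_encode (n, k)) = Some 0 \<and> (\<forall>j<k. F p (prod_encode (n, j)) \<noteq> None)
      then Some (LEAST k. F p (prod_encode (n, k)) = Some 0)
      else None)"

definition the_opt :: "('a \<Rightarrow> bool) \<Rightarrow> 'a option" where
  "the_opt P = (if \<exists>!y. P y then Some (THE y. P y) else None)"

lemma the_opt_eq_Some_iff: "the_opt P = Some y \<longleftrightarrow> P y \<and> (\<forall>z. P z \<longrightarrow> z = y)"
proof (cases "\<exists>!y. P y")
  case True
  then obtain u where u: "P u" "\<And>z. P z \<Longrightarrow> z = u" by blast
  then have "(THE y. P y) = u" by (rule the_equality)
  then have "the_opt P = Some u" using True by (simp add: the_opt_def)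
  with u show ?thesis by (metis option.inject)
next
  case False
  then have "the_opt P = None" by (simp only: the_opt_def if_False)
  moreover have "\<not> (P y \<and> (\<forall>z. P z \<longrightarrow> z = y))" using False by blast
  ultimately show ?thesis by simp
qed

definition computable_cantor :: "(cantor \<Rightarrow> cantor option) \<Rightarrow> bool" where
  "computable_cantor F \<longleftrightarrow>
     (\<exists>\<Phi>. partial_recursive \<Phi> \<and>
        (\<forall>p. F p = the_opt (\<lambda>q. \<forall>n. \<Phi> p n = Some (of_bool (q n)))))"


section \<open>Represented spaces\<close>

text \<open>
  A represented space \<open>(X, \<delta>)\<close> is given by the partial map \<open>\<delta>\<close> alone: as \<open>\<delta>\<close> is onto, the underlying
  set \<open>X\<close> is \<open>ran \<delta>\<close>.
\<close>

type_synonym 'a rep = "cantor \<Rightarrow> 'a option"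

definition rep_topology :: "'a rep \<Rightarrow> 'a topology" where
  "rep_topology \<delta> = topology (\<lambda>U. U \<subseteq> ran \<delta> \<and>
     openin (top_of_set (dom \<delta>)) {p \<in> dom \<delta>. the (\<delta> p) \<in> U})"

lemma openin_rep_topology:
  "openin (rep_topology \<delta>) U \<longleftrightarrow>
     U \<subseteq> ran \<delta> \<and> openin (top_of_set (dom \<delta>)) {p \<in> dom \<delta>. the (\<delta> p) \<in> U}"
proof -
  let ?P = "\<lambda>U. U \<subseteq> ran \<delta> \<and> openin (top_of_set (dom \<delta>)) {p \<in> dom \<delta>. the (\<delta> p) \<in> U}"
  have "istopology ?P"
    unfolding istopology_def
  proof (intro conjI allI impI)
    fix S T assume S: "?P S" and T: "?P T"
    show "S \<inter> T \<subseteq> ran \<delta>" using S by blast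
    have "{p \<in> dom \<delta>. the (\<delta> p) \<in> S \<inter> T} =
        {p \<in> dom \<delta>. the (\<delta> p) \<in> S} \<inter> {p \<in> dom \<delta>. the (\<delta> p) \<in> T}" by blast
    then show "openin (top_of_set (dom \<delta>)) {p \<in> dom \<delta>. the (\<delta> p) \<in> S \<inter> T}"
      using S T by (simp only: openin_Int)
  next
    fix K assume K: "\<forall>S\<in>K. ?P S"
    show "\<Union>K \<subseteq> ran \<delta>" using K by blast
    have "{p \<in> dom \<delta>. the (\<delta> p) \<in> \<Union>K} = \<Union>((\<lambda>S. {p \<in> dom \<delta>. the (\<delta> p) \<in> S}) ` K)" by blast
    then show "openin (top_of_set (dom \<delta>)) {p \<in> dom \<delta>. the (\<delta> p) \<in> \<Union>K}"
      using K by (simp only:) (rule openin_Union, blast)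
  qed
  then show ?thesis
    unfolding rep_topology_def by (simp add: topology_inverse')
qed

text \<open>
  A partial multivalued map is a set-valued function; its domain consists of the points with
  nonempty value.
\<close>

definition realizes ::
    "'a rep \<Rightarrow> 'b rep \<Rightarrow> (cantor \<Rightarrow> cantor option) \<Rightarrow> ('a \<Rightarrow> 'b set) \<Rightarrow> bool" where
  "realizes \<delta>X \<delta>Y F f \<longleftrightarrow>
     (\<forall>p x. \<delta>X p = Some x \<and> f x \<noteq> {} \<longrightarrow> (\<exists>q y. F p = Some q \<and> \<delta>Y q = Some y \<and> y \<in> f x))"

definition computable_mv :: "'a rep \<Rightarrow> 'b rep \<Rightarrow> ('a \<Rightarrow> 'b set) \<Rightarrow> bool" where
  "computable_mv \<delta>X \<delta>Y f \<longleftrightarrow> (\<exists>F. computable_cantor F \<and> realizes \<delta>X \<delta>Y F f)"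

definition computable_map :: "'a rep \<Rightarrow> 'b rep \<Rightarrow> ('a \<Rightarrow> 'b) \<Rightarrow> bool" where
  "computable_map \<delta>X \<delta>Y f \<longleftrightarrow> computable_mv \<delta>X \<delta>Y (\<lambda>x. {f x})"

definition nat_rep :: "nat rep" where
  "nat_rep p = the_opt (\<lambda>n. p = (\<lambda>k. k = n))"

definition bool_rep :: "bool rep" where
  "bool_rep p = Some (p 0)"

definition prod_rep :: "'a rep \<Rightarrow> 'b rep \<Rightarrow> ('a \<times> 'b) rep" where
  "prod_rep \<delta>X \<delta>Y p =
     (case (\<delta>X (\<lambda>n. p (2 * n)), \<delta>Y (\<lambda>n. p (2 * n + 1))) of
        (Some x, Some y) \<Rightarrow> Some (x, y) | _ \<Rightarrow> None)"

definition seq_rep :: "'a rep \<Rightarrow> (nat \<Rightarrow> 'a) rep" where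
  "seq_rep \<delta> p = the_opt (\<lambda>x. \<forall>n. \<delta> (\<lambda>k. p (prod_encode (n, k))) = Some (x n))"

text \<open>Sierpinski space, with \<open>True\<close> for \<open>\<top>\<close> and \<open>False\<close> for \<open>\<bottom>\<close>.\<close>

definition sierpinski_rep :: "bool rep" where
  "sierpinski_rep p = Some (\<exists>n. p n)"

text \<open>
  The partial continuous function on Cantor space coded by \<open>p\<close>: the sequence \<open>p\<close> is read as the set of
  all triples \<open>(w, n, b)\<close> with \<open>p \<langle>w, n, b\<rangle> = 1\<close>, each asserting that inputs extending the finite word \<open>w\<close>
  have an output with \<open>n\<close>-th bit \<open>b\<close>. Up to computable translation of names, this is the same as letting
  \<open>p\<close> consist of a program together with an oracle for it.
\<close>

definition word_code :: "cantor \<Rightarrow> nat \<Rightarrow> nat" where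
  "word_code q k = list_encode (map (\<lambda>i. of_bool (q i)) [0..<k])"

definition cantor_app :: "cantor \<Rightarrow> cantor \<Rightarrow> cantor option" where
  "cantor_app p q = the_opt (\<lambda>r. \<forall>n b.
     r n = b \<longleftrightarrow> (\<exists>k. p (prod_encode (word_code q k, prod_encode (n, of_bool b)))))"

text \<open>
  Elements of the space of continuous maps from \<open>X\<close> to \<open>Y\<close> are made unique as HOL functions by
  extensionality outside \<open>X = ran \<delta>X\<close>.
\<close>

definition fun_rep :: "'a rep \<Rightarrow> 'b rep \<Rightarrow> ('a \<Rightarrow> 'b) rep" where
  "fun_rep \<delta>X \<delta>Y p =
     the_opt (\<lambda>f. f \<in> extensional (ran \<delta>X) \<and> realizes \<delta>X \<delta>Y (cantor_app p) (\<lambda>x. {f x}))"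

lemma fun_rep_eq_Some_iff:
  "fun_rep \<delta>X \<delta>Y p = Some f \<longleftrightarrow>
     f \<in> extensional (ran \<delta>X) \<and> realizes \<delta>X \<delta>Y (cantor_app p) (\<lambda>x. {f x})"
proof -
  have "f = g" if fg: "f \<in> extensional (ran \<delta>X)" "realizes \<delta>X \<delta>Y (cantor_app p) (\<lambda>x. {f x})"
    "g \<in> extensional (ran \<delta>X)" "realizes \<delta>X \<delta>Y (cantor_app p) (\<lambda>x. {g x})" for f g
  proof (rule extensionalityI[OF fg(1,3)])
    fix x assume "x \<in> ran \<delta>X"
    then obtain q where "\<delta>X q = Some x" by (auto simp: ran_def)
    then obtain r y r' y' where "cantor_app p q = Some r" "\<delta>Y r = Some y" "y = f x"
      and "cantor_app p q = Some r'" "\<delta>Y r' = Some y'" "y' = g x"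
      using fg(2,4) unfolding realizes_def by (meson singletonD insert_not_empty)
    then show "f x = g x" by simp
  qed
  then show ?thesis
    unfolding fun_rep_def the_opt_eq_Some_iff by blast
qed

definition open_rep :: "'a rep \<Rightarrow> 'a set rep" where
  "open_rep \<delta> p = map_option (\<lambda>f. {x \<in> ran \<delta>. f x}) (fun_rep \<delta> sierpinski_rep p)"

definition closed_rep :: "'a rep \<Rightarrow> 'a set rep" where
  "closed_rep \<delta> p = map_option (\<lambda>U. ran \<delta> - U) (open_rep \<delta> p)"

definition computably_compact :: "'a rep \<Rightarrow> bool" where
  "computably_compact \<delta> \<longleftrightarrow> computable_map (closed_rep \<delta>) sierpinski_rep (\<lambda>A. A = {})"


section \<open>Dyadic subbases\<close>

text \<open>
  \<open>\<T> = {0, 1, \<bottom>}\<close> is \<open>bool option\<close> with \<open>0 = Some False\<close>, \<open>1 = Some True\<close> and \<open>\<bottom> = None\<close>. The domain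
  of a sequence over \<open>\<T>\<close> is then \<^const>\<open>dom\<close>.
\<close>

definition plotkin_rep :: "bool option rep" where
  "plotkin_rep p = Some (if \<exists>n. p n then Some (odd (LEAST n. p n)) else None)"

abbreviation plotkin_seq_rep :: "(nat \<Rightarrow> bool option) rep" where
  "plotkin_seq_rep \<equiv> seq_rep plotkin_rep"

definition dyadic_subbase :: "'a rep \<Rightarrow> (nat \<Rightarrow> bool \<Rightarrow> 'a set) \<Rightarrow> bool" where
  "dyadic_subbase \<delta> S \<longleftrightarrow>
     (\<forall>n i. S n i \<in> ran (open_rep \<delta>)) \<and>
     rep_topology \<delta> = topology (arbitrary union_of
       (finite intersection_of (\<lambda>U. \<exists>n i. U = S n i) relative_to ran \<delta>)) \<and>
     (\<forall>n. S n False \<inter> S n True = {})"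

definition subbase_code :: "(nat \<Rightarrow> bool \<Rightarrow> 'a set) \<Rightarrow> 'a \<Rightarrow> nat \<Rightarrow> bool option" where
  "subbase_code S x n =
     (if x \<in> S n False then Some False else if x \<in> S n True then Some True else None)"

text \<open>
  The partial inverse of \<open>subbase_code S\<close> is stated as a multivalued map. It is single-valued if the
  subbase generates a \<open>T\<^sub>0\<close> topology, since then \<open>subbase_code S\<close> is injective on \<open>ran \<delta>\<close>.
\<close>

definition computable_dyadic_subbase :: "'a rep \<Rightarrow> (nat \<Rightarrow> bool \<Rightarrow> 'a set) \<Rightarrow> bool" where
  "computable_dyadic_subbase \<delta> S \<longleftrightarrow>
     dyadic_subbase \<delta> S \<and>
     computable_map (prod_rep nat_rep bool_rep) (open_rep \<delta>) (\<lambda>(n, i). S n i) \<and>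
     computable_map \<delta> plotkin_seq_rep (subbase_code S) \<and>
     computable_mv plotkin_seq_rep \<delta> (\<lambda>p. {x \<in> ran \<delta>. subbase_code S x = p})"

definition subbase_inter ::
    "'a rep \<Rightarrow> (nat \<Rightarrow> bool \<Rightarrow> 'a set) \<Rightarrow> (nat \<Rightarrow> bool option) \<Rightarrow> 'a set" where
  "subbase_inter \<delta> S p = {x \<in> ran \<delta>. \<forall>k \<in> dom p. x \<in> S k (the (p k))}"

definition subbase_bar ::
    "'a rep \<Rightarrow> (nat \<Rightarrow> bool \<Rightarrow> 'a set) \<Rightarrow> (nat \<Rightarrow> bool option) \<Rightarrow> 'a set" where
  "subbase_bar \<delta> S p = {x \<in> ran \<delta>. \<forall>k \<in> dom p. x \<in> ran \<delta> - S k (\<not> the (p k))}"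

definition pad :: "bool option list \<Rightarrow> nat \<Rightarrow> bool option" where
  "pad e k = (if k < length e then e ! k else None)"

definition proper_subbase :: "'a rep \<Rightarrow> (nat \<Rightarrow> bool \<Rightarrow> 'a set) \<Rightarrow> bool" where
  "proper_subbase \<delta> S \<longleftrightarrow>
     (\<forall>e. rep_topology \<delta> closure_of subbase_inter \<delta> S (pad e) = subbase_bar \<delta> S (pad e))"

end

theory Submission
  imports Defs
begin

text \<open>
  A closed set \<open>A\<close> is handed down a binary tree. At a node of level \<open>n\<close>, the part of \<open>A\<close> that arrives is
  split by the \<open>n\<close>-th pair \<open>(C, D)\<close> of finite unions of basic sets with disjoint closures: the left
  child receives the points outside \<open>D\<close>, the right child those outside \<open>C\<close>. Meanwhile one searches for a
  larger pair \<open>(C', D')\<close> of the same kind that covers the arriving part, and once it is found, it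
  replaces \<open>(C, D)\<close>, so that the two children then receive disjoint parts. If \<open>A\<close> is finite, the search
  succeeds: a point outside the closure of \<open>C\<close> (or of \<open>D\<close>) has a basic neighbourhood that can be added to
  \<open>D\<close> (or to \<open>C\<close>). As the subbase is proper, closures of basic sets are given by finite data, and
  compactness makes all these conditions semidecidable.

  The sequence coding \<open>A\<close> records at each node the first child whose part is found to be empty, and
  \<open>\<bottom>\<close> if there is none; one further entry records whether \<open>A\<close> is empty. The pairs separate points, hence
  \<open>A\<close> is recovered as the set of points lying on unabandoned branches. For a finite nonempty \<open>A\<close> the
  parts at the two children of a node are disjoint, so there are \<open>|A| - 1\<close> nodes where both are
  nonempty; together with the further entry this gives \<open>|A|\<close> times \<open>\<bottom>\<close>.

  Effectivity rests on two facts about partial recursive functionals: oracles may be substituted, and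
  every functional is approximated in stages, the \<open>s\<close>-th of which reads only \<open>s\<close> bits of the oracle.
\<close>

section \<open>Recursive functionals\<close>

abbreviation pfst :: "nat \<Rightarrow> nat" where "pfst n \<equiv> fst (prod_decode n)"
abbreviation psnd :: "nat \<Rightarrow> nat" where "psnd n \<equiv> snd (prod_decode n)"

definition total_recursive :: "(cantor \<Rightarrow> nat \<Rightarrow> nat) \<Rightarrow> bool" where
  "total_recursive f \<longleftrightarrow> partial_recursive (\<lambda>p n. Some (f p n))"

definition decidable :: "(cantor \<Rightarrow> nat \<Rightarrow> bool) \<Rightarrow> bool" where
  "decidable P \<longleftrightarrow> total_recursive (\<lambda>p n. of_bool (P p n))"

named_theorems recursive_intros

section \<open>Closure of total recursive functions under composition and recursion\<close>

lemma partial_recursive_comp_total: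
  assumes "partial_recursive F" "total_recursive g"
  shows "partial_recursive (\<lambda>p n. F p (g p n))"
  using partial_recursive.comp[OF assms(1) assms(2)[unfolded total_recursive_def]] by simp

lemma total_recursive_comp:
  assumes "total_recursive f" "total_recursive g"
  shows "total_recursive (\<lambda>p n. f p (g p n))"
  using partial_recursive_comp_total[of "\<lambda>p n. Some (f p n)"] assms
  by (simp add: total_recursive_def)

lemma total_recursive_Suc [recursive_intros]:
  "total_recursive f \<Longrightarrow> total_recursive (\<lambda>p n. Suc (f p n))"
  using total_recursive_comp[of "\<lambda>p n. Suc n" f] partial_recursive.succ
  by (simp add: total_recursive_def)

lemma total_recursive_const [recursive_intros]: "total_recursive (\<lambda>p n. c)"
proof (induction c)
  case 0
  show ?case using partial_recursive.zero by (simp add: total_recursive_def)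
qed (rule total_recursive_Suc)

lemma total_recursive_pfst [recursive_intros]:
  "total_recursive f \<Longrightarrow> total_recursive (\<lambda>p n. pfst (f p n))"
  using total_recursive_comp[of "\<lambda>p n. pfst n" f] partial_recursive.left
  by (simp add: total_recursive_def)

lemma total_recursive_psnd [recursive_intros]:
  "total_recursive f \<Longrightarrow> total_recursive (\<lambda>p n. psnd (f p n))"
  using total_recursive_comp[of "\<lambda>p n. psnd n" f] partial_recursive.right
  by (simp add: total_recursive_def)

lemma total_recursive_pair [recursive_intros]:
  "total_recursive f \<Longrightarrow> total_recursive g \<Longrightarrow>
    total_recursive (\<lambda>p n. prod_encode (f p n, g p n))"
  unfolding total_recursive_def by (drule (1) partial_recursive.pair) simp

lemma total_recursive_id [recursive_intros]: "total_recursive (\<lambda>p n. n)"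
  using total_recursive_pair[of "\<lambda>p n. pfst n" "\<lambda>p n. psnd n"]
    partial_recursive.left partial_recursive.right
  by (simp add: total_recursive_def)

text \<open>Several arguments are passed as one coded tuple; this form allows substitution into a
  curried function without handling codes.\<close>

lemma total_recursive_comp2:
  assumes "total_recursive (\<lambda>p m. f p (pfst m) (psnd m))" "total_recursive a" "total_recursive b"
  shows "total_recursive (\<lambda>p n. f p (a p n) (b p n))"
  using total_recursive_comp[OF assms(1) total_recursive_pair[OF assms(2,3)]] by simp

lemma total_recursive_comp3:
  assumes "total_recursive (\<lambda>p m. f p (pfst m) (pfst (psnd m)) (psnd (psnd m)))"
    "total_recursive a" "total_recursive b" "total_recursive c"
  shows "total_recursive (\<lambda>p n. f p (a p n) (b p n) (c p n))"
  using total_recursive_comp[OF assms(1)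
      total_recursive_pair[OF assms(2) total_recursive_pair[OF assms(3,4)]]] by simp

lemmas decidable_comp = total_recursive_comp[where f = "\<lambda>p n. of_bool (P p n)" for P,
    folded decidable_def]
lemmas decidable_comp2 = total_recursive_comp2[where f = "\<lambda>p m n. of_bool (P p m n)" for P,
    folded decidable_def]
lemmas decidable_comp3 = total_recursive_comp3[where f = "\<lambda>p k m n. of_bool (P p k m n)" for P,
    folded decidable_def]

lemma total_recursive_rec_nat [recursive_intros]:
  assumes "total_recursive a"
    and "total_recursive (\<lambda>p m. g p (pfst m) (pfst (psnd m)) (psnd (psnd m)))"
    and "total_recursive b"
  shows "total_recursive (\<lambda>p n. rec_nat (a p n) (g p n) (b p n))"
proof -
  have eq: "rec_nat (Some x) (\<lambda>i r. Option.bind r (\<lambda>v. Some (h i v))) k = Some (rec_nat x h k)"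
    for x :: nat and h k by (induction k) auto
  have "total_recursive (\<lambda>p n. rec_nat (a p (pfst n)) (g p (pfst n)) (psnd n))"
    using partial_recursive.prec[OF assms(1,2)[unfolded total_recursive_def]]
    by (simp add: total_recursive_def case_prod_beta eq)
  from total_recursive_comp[OF this total_recursive_pair[OF total_recursive_id assms(3)]]
  show ?thesis by simp
qed

lemma decidable_query [recursive_intros]:
  assumes "total_recursive a"
  shows "decidable (\<lambda>p n. p (a p n))"
  using decidable_comp[of "\<lambda>p n. p n" a] assms partial_recursive.query
  by (simp add: decidable_def total_recursive_def)

lemma total_recursive_of_bool [recursive_intros]:
  "decidable P \<Longrightarrow> total_recursive (\<lambda>p n. of_bool (P p n))"
  by (simp add: decidable_def)

section \<open>Arithmetic, decidable predicates and bounded search\<close>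

lemma total_recursive_add [recursive_intros]:
  assumes "total_recursive a" "total_recursive b"
  shows "total_recursive (\<lambda>p n. a p n + b p n)"
proof -
  have "rec_nat x (\<lambda>i v. Suc v) k = x + k" for x k by (induction k) auto
  moreover have "total_recursive (\<lambda>p n. rec_nat (a p n) (\<lambda>i v. Suc v) (b p n))"
    by (intro recursive_intros assms)
  ultimately show ?thesis by simp
qed

lemma total_recursive_mult [recursive_intros]:
  assumes "total_recursive a" "total_recursive b"
  shows "total_recursive (\<lambda>p n. a p n * b p n)"
proof -
  have "rec_nat 0 (\<lambda>i v. v + x) k = x * k" for x k by (induction k) auto
  moreover have "total_recursive (\<lambda>p n. rec_nat 0 (\<lambda>i v. v + a p n) (b p n))"
    by (intro recursive_intros assms total_recursive_comp[OF assms(1)])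
  ultimately show ?thesis by simp
qed

lemma total_recursive_power [recursive_intros]:
  assumes "total_recursive a" "total_recursive b"
  shows "total_recursive (\<lambda>p n. a p n ^ b p n)"
proof -
  have "rec_nat 1 (\<lambda>i v. v * x) k = x ^ k" for x k :: nat by (induction k) auto
  moreover have "total_recursive (\<lambda>p n. rec_nat 1 (\<lambda>i v. v * a p n) (b p n))"
    by (intro recursive_intros assms total_recursive_comp[OF assms(1)])
  ultimately show ?thesis by simp
qed

lemma total_recursive_diff [recursive_intros]:
  assumes "total_recursive a" "total_recursive b"
  shows "total_recursive (\<lambda>p n. a p n - b p n)"
proof -
  \<comment> \<open>A recursion step that returns its own counter computes the predecessor.\<close>
  have pred: "rec_nat 0 (\<lambda>i v. i) k = k - 1" for k by (cases k) auto
  have "rec_nat x (\<lambda>i v. rec_nat 0 (\<lambda>i v. i) v) k = x - k" for x k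
    by (induction k) (auto simp: pred)
  moreover have
    "total_recursive (\<lambda>p n. rec_nat (a p n) (\<lambda>i v. rec_nat 0 (\<lambda>i v. i) v) (b p n))"
    by (intro recursive_intros assms)
  ultimately show ?thesis by simp
qed

lemma decidable_eq0:
  assumes "total_recursive a"
  shows "decidable (\<lambda>p n. a p n = 0)"
proof -
  have "total_recursive (\<lambda>p n. 1 - a p n)"
    by (intro recursive_intros assms)
  moreover have "1 - a p n = of_bool (a p n = 0)" for p n by simp
  ultimately show ?thesis by (simp add: decidable_def)
qed

lemma decidable_const [recursive_intros]: "decidable (\<lambda>p n. b)"
  unfolding decidable_def by (rule total_recursive_const)

lemma decidable_not [recursive_intros]:
  assumes "decidable P"
  shows "decidable (\<lambda>p n. \<not> P p n)"
  using decidable_eq0[OF assms[unfolded decidable_def]] by simp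

lemma decidable_conj [recursive_intros]:
  assumes "decidable P" "decidable Q"
  shows "decidable (\<lambda>p n. P p n \<and> Q p n)"
  using total_recursive_mult[OF assms[unfolded decidable_def]]
  by (simp add: decidable_def of_bool_conj)

lemma decidable_disj [recursive_intros]:
  assumes "decidable P" "decidable Q"
  shows "decidable (\<lambda>p n. P p n \<or> Q p n)"
  using decidable_not[OF decidable_conj[OF assms[THEN decidable_not]]] by simp

lemma decidable_imp [recursive_intros]:
  assumes "decidable P" "decidable Q"
  shows "decidable (\<lambda>p n. P p n \<longrightarrow> Q p n)"
  unfolding imp_conv_disj by (intro recursive_intros assms)

lemma decidable_le [recursive_intros]:
  assumes "total_recursive a" "total_recursive b"
  shows "decidable (\<lambda>p n. a p n \<le> b p n)"
  using decidable_eq0[OF total_recursive_diff[OF assms]] by simp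

lemma decidable_less [recursive_intros]:
  assumes "total_recursive a" "total_recursive b"
  shows "decidable (\<lambda>p n. a p n < b p n)"
  using decidable_le[OF total_recursive_Suc[OF assms(1)] assms(2)] by (simp add: Suc_le_eq)

lemma decidable_eq [recursive_intros]:
  assumes "total_recursive a" "total_recursive b"
  shows "decidable (\<lambda>p n. a p n = b p n)"
  using decidable_conj[OF decidable_le[OF assms] decidable_le[OF assms(2,1)]]
  by (simp add: eq_iff)

lemma total_recursive_if [recursive_intros]:
  assumes "decidable P" "total_recursive a" "total_recursive b"
  shows "total_recursive (\<lambda>p n. if P p n then a p n else b p n)"
proof -
  have "total_recursive (\<lambda>p n. of_bool (P p n) * a p n + of_bool (\<not> P p n) * b p n)"
    by (intro recursive_intros assms)
  moreover have "of_bool (P p n) * a p n + of_bool (\<not> P p n) * b p n =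
      (if P p n then a p n else b p n)" for p n by simp
  ultimately show ?thesis by simp
qed

lemma decidable_if [recursive_intros]:
  assumes "decidable P" "decidable Q" "decidable R"
  shows "decidable (\<lambda>p n. if P p n then Q p n else R p n)"
  using total_recursive_if[OF assms(1) assms(2,3)[unfolded decidable_def]]
  by (simp add: decidable_def if_distrib)

lemma decidable_iff [recursive_intros]:
  assumes "decidable P" "decidable Q"
  shows "decidable (\<lambda>p n. P p n = Q p n)"
proof -
  have "(if P p n then Q p n else \<not> Q p n) \<longleftrightarrow> (P p n = Q p n)" for p n by simp
  with decidable_if[OF assms decidable_not[OF assms(2)]] show ?thesis by (simp only:)
qed

lemma decidable_Ex_less [recursive_intros]:
  assumes P: "decidable (\<lambda>p m. P p (pfst m) (psnd m))" and b: "total_recursive b"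
  shows "decidable (\<lambda>p n. \<exists>k<b p n. P p n k)"
proof -
  have eq: "rec_nat 0 (\<lambda>i v. of_bool (v = 1 \<or> Q i)) k = (of_bool (\<exists>i<k. Q i) :: nat)" for Q k
    by (induction k) (auto simp: less_Suc_eq)
  have "total_recursive (\<lambda>p n. rec_nat 0 (\<lambda>i v. of_bool (v = 1 \<or> P p n i)) (b p n))"
    by (intro recursive_intros decidable_comp2[OF P] b)
  then show ?thesis by (simp only: eq decidable_def)
qed

lemma decidable_All_less [recursive_intros]:
  assumes "decidable (\<lambda>p m. P p (pfst m) (psnd m))" "total_recursive b"
  shows "decidable (\<lambda>p n. \<forall>k<b p n. P p n k)"
  using decidable_not[OF decidable_Ex_less[OF decidable_not[OF assms(1)] assms(2)]] by simp

lemma decidable_Ex_le [recursive_intros]: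
  assumes "decidable (\<lambda>p m. P p (pfst m) (psnd m))" "total_recursive b"
  shows "decidable (\<lambda>p n. \<exists>k\<le>b p n. P p n k)"
  using decidable_Ex_less[OF assms(1) total_recursive_Suc[OF assms(2)]]
  by (simp add: less_Suc_eq_le)

lemma total_recursive_Least:
  assumes P: "decidable (\<lambda>p m. P p (pfst m) (psnd m))" and ex: "\<And>p n. \<exists>k. P p n k"
  shows "total_recursive (\<lambda>p n. LEAST k. P p n k)"
proof -
  have "total_recursive (\<lambda>p m. of_bool (\<not> P p (pfst m) (psnd m)))"
    by (intro recursive_intros P)
  from partial_recursive.mu[OF this[unfolded total_recursive_def]]
  show ?thesis using ex by (simp add: total_recursive_def)
qed

lemma total_recursive_div [recursive_intros]:
  assumes "total_recursive a" "total_recursive b"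
  shows "total_recursive (\<lambda>p n. a p n div b p n)"
proof -
  \<comment> \<open>Division as an unbounded search; the disjunct \<open>y = 0\<close> makes it stop
    at 0 for the divisor zero, in accordance with \<open>div\<close>.\<close>
  have eq: "(LEAST k. y = 0 \<or> x < Suc k * y) = x div y" for x y :: nat
  proof (cases "y = 0")
    case False
    show ?thesis
    proof (rule Least_equality)
      show "y = 0 \<or> x < Suc (x div y) * y"
        using False dividend_less_div_times[of y x] by simp
      show "x div y \<le> k" if "y = 0 \<or> x < Suc k * y" for k
        using that False less_mult_imp_div_less[of x "Suc k" y] by simp
    qed
  qed simp
  have "total_recursive (\<lambda>p n. LEAST k. b p n = 0 \<or> a p n < Suc k * b p n)"
  proof (rule total_recursive_Least)
    show "decidable (\<lambda>p m. b p (pfst m) = 0 \<or> a p (pfst m) < Suc (psnd m) * b p (pfst m))"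
      by (intro recursive_intros assms[THEN total_recursive_comp])
    show "\<exists>k. b p n = 0 \<or> a p n < Suc k * b p n" for p n
      by (rule exI[of _ "a p n"]) (cases "b p n", auto)
  qed
  then show ?thesis by (simp only: eq)
qed

lemma decidable_even [recursive_intros]:
  assumes "total_recursive a"
  shows "decidable (\<lambda>p n. even (a p n))"
proof -
  have "decidable (\<lambda>p n. 2 * (a p n div 2) = a p n)"
    by (intro recursive_intros assms)
  moreover have "2 * (k div 2) = k \<longleftrightarrow> even k" for k :: nat by presburger
  ultimately show ?thesis by simp
qed

lemma decidable_set_decode [recursive_intros]:
  assumes "total_recursive a" "total_recursive b"
  shows "decidable (\<lambda>p n. a p n \<in> set_decode (b p n))"
proof -
  have "decidable (\<lambda>p n. \<not> even (b p n div 2 ^ a p n))"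
    by (intro recursive_intros assms)
  then show ?thesis by (simp add: set_decode_def)
qed

lemma less_of_mem_set_decode: "m \<in> set_decode e \<Longrightarrow> m < e"
  by (rule order_less_le_trans[OF less_exp]) (rule ccontr, simp add: set_decode_def)

lemma decidable_Ball_set_decode [recursive_intros]:
  assumes "decidable (\<lambda>p m. P p (pfst m) (psnd m))" "total_recursive b"
  shows "decidable (\<lambda>p n. \<forall>k \<in> set_decode (b p n). P p n k)"
proof -
  have "decidable (\<lambda>p n. \<forall>k<b p n. k \<in> set_decode (b p n) \<longrightarrow> P p n k)"
    by (intro recursive_intros assms total_recursive_comp[OF assms(2)])
  moreover have "(\<forall>k<c. k \<in> set_decode c \<longrightarrow> Q k) \<longleftrightarrow> (\<forall>k \<in> set_decode c. Q k)" for c Q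
    using less_of_mem_set_decode by blast
  ultimately show ?thesis by simp
qed

lemma decidable_Bex_set_decode [recursive_intros]:
  assumes "decidable (\<lambda>p m. P p (pfst m) (psnd m))" "total_recursive b"
  shows "decidable (\<lambda>p n. \<exists>k \<in> set_decode (b p n). P p n k)"
  using decidable_not[OF decidable_Ball_set_decode[OF decidable_not[OF assms(1)] assms(2)]] by simp

subsection \<open>Oracle substitution\<close>

text \<open>The parameter selecting the oracle travels along as first component of the argument. A
  query becomes an evaluation of \<open>g\<close>, and the other cases only regroup tuples.\<close>

lemma partial_recursive_substitute_oracle:
  assumes "partial_recursive F" and g: "decidable (\<lambda>p m. g p (pfst m) (psnd m))"
  shows "partial_recursive (\<lambda>p n. F (g p (pfst n)) (psnd n))"
  using assms(1)
proof induction
  case zero show ?case by (rule partial_recursive.zero)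
next
  case succ
  show ?case by (fold total_recursive_def) (intro recursive_intros)
next
  case left
  show ?case by (fold total_recursive_def) (intro recursive_intros)
next
  case right
  show ?case by (fold total_recursive_def) (intro recursive_intros)
next
  case query
  have "total_recursive (\<lambda>p n. of_bool (g p (pfst n) (psnd n)))"
    by (intro recursive_intros g)
  then show ?case by (simp add: total_recursive_def)
next
  case (pair F G)
  show ?case using partial_recursive.pair[OF pair.IH] by simp
next
  case (comp F G)
  have "partial_recursive (\<lambda>p n. Some (pfst n))" by (rule partial_recursive.left)
  from partial_recursive.comp[OF comp.IH(1) partial_recursive.pair[OF this comp.IH(2)]]
  show ?case by (simp add: Option.bind_assoc)
next
  case (prec F G)
  have "total_recursive (\<lambda>p m. prod_encode (pfst (pfst m),
      prod_encode (psnd (pfst m), prod_encode (pfst (psnd m), psnd (psnd m)))))"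
    by (intro recursive_intros)
  from partial_recursive.prec[OF prec.IH(1) partial_recursive_comp_total[OF prec.IH(2) this]]
  have "partial_recursive (\<lambda>p n. case prod_decode n of (a, k) \<Rightarrow>
      rec_nat (F (g p (pfst a)) (psnd a))
        (\<lambda>i r. Option.bind r (\<lambda>v. G (g p (pfst a)) (prod_encode (psnd a, prod_encode (i, v))))) k)"
    by simp
  moreover have "total_recursive (\<lambda>p n.
      prod_encode (prod_encode (pfst n, pfst (psnd n)), psnd (psnd n)))"
    by (intro recursive_intros)
  ultimately show ?case
    by (drule_tac partial_recursive_comp_total) (auto simp: case_prod_beta)
next
  case (mu F)
  have "total_recursive (\<lambda>p m. prod_encode (pfst (pfst m), prod_encode (psnd (pfst m), psnd m)))"
    by (intro recursive_intros)
  from partial_recursive.mu[OF partial_recursive_comp_total[OF mu.IH this]]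
  show ?case by (simp only: prod_encode_inverse fst_conv snd_conv)
qed

lemma total_recursive_substitute_oracle:
  assumes "total_recursive f" "decidable (\<lambda>p m. g p (pfst m) (psnd m))" "total_recursive a"
  shows "total_recursive (\<lambda>p n. f (g p n) (a p n))"
proof -
  have "total_recursive (\<lambda>p n. f (g p (pfst n)) (psnd n))"
    using partial_recursive_substitute_oracle[OF assms(1)[unfolded total_recursive_def] assms(2)]
    by (simp add: total_recursive_def)
  from total_recursive_comp[OF this total_recursive_pair[OF total_recursive_id assms(3)]]
  show ?thesis by simp
qed

lemmas decidable_substitute_oracle =
  total_recursive_substitute_oracle[where f = "\<lambda>p n. of_bool (P p n)" for P, folded decidable_def]

subsection \<open>Stagewise approximation\<close>

text \<open>
  \<open>T p s n\<close> runs the computation of \<open>F p n\<close> for \<open>s\<close> stages, reading only the first \<open>s\<close> bits of \<open>p\<close>;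
  it yields \<open>Suc v\<close> once the value \<open>v\<close> has been found, and \<open>0\<close> before.
\<close>

definition approximates ::
    "(cantor \<Rightarrow> nat \<Rightarrow> nat \<Rightarrow> nat) \<Rightarrow> (cantor \<Rightarrow> nat \<Rightarrow> nat option) \<Rightarrow> bool" where
  "approximates T F \<longleftrightarrow>
     total_recursive (\<lambda>p m. T p (pfst m) (psnd m)) \<and>
     (\<forall>p n v. F p n = Some v \<longleftrightarrow> (\<exists>s. T p s n = Suc v)) \<and>
     (\<forall>p s s' n v. T p s n = Suc v \<longrightarrow> s \<le> s' \<longrightarrow> T p s' n = Suc v) \<and>
     (\<forall>p p' s n. (\<forall>i<s. p i = p' i) \<longrightarrow> T p s n = T p' s n)"

lemma approximates_total:
  assumes "total_recursive f" "\<And>p p' n. f p n = f p' n"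
  shows "approximates (\<lambda>p s n. Suc (f p n)) (\<lambda>p n. Some (f p n))"
proof -
  have "total_recursive (\<lambda>p m. Suc (f p (psnd m)))"
    by (intro recursive_intros total_recursive_comp[OF assms(1)])
  then show ?thesis using assms(2) by (auto simp: approximates_def)
qed

lemma approximatesD:
  assumes "approximates T F"
  shows "total_recursive a \<Longrightarrow> total_recursive b \<Longrightarrow> total_recursive (\<lambda>p n. T p (a p n) (b p n))"
    and "F p n = Some v \<longleftrightarrow> (\<exists>s. T p s n = Suc v)"
    and "T p s n = Suc v \<Longrightarrow> s \<le> s' \<Longrightarrow> T p s' n = Suc v"
    and "(\<And>i. i < s \<Longrightarrow> p i = p' i) \<Longrightarrow> T p s n = T p' s n"
proof -
  note h = assms[unfolded approximates_def]
  show "total_recursive a \<Longrightarrow> total_recursive b \<Longrightarrow> total_recursive (\<lambda>p n. T p (a p n) (b p n))"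
    by (rule total_recursive_comp2[OF h[THEN conjunct1]])
  show "F p n = Some v \<longleftrightarrow> (\<exists>s. T p s n = Suc v)"
    by (rule h[THEN conjunct2, THEN conjunct1, rule_format])
  show "T p s n = Suc v \<Longrightarrow> s \<le> s' \<Longrightarrow> T p s' n = Suc v"
    by (rule h[THEN conjunct2, THEN conjunct2, THEN conjunct1, rule_format])
  show "(\<And>i. i < s \<Longrightarrow> p i = p' i) \<Longrightarrow> T p s n = T p' s n"
    by (rule h[THEN conjunct2, THEN conjunct2, THEN conjunct2, rule_format])
qed

lemma approximates_query:
  "approximates (\<lambda>p s n. if n < s then Suc (of_bool (p n)) else 0) (\<lambda>p n. Some (of_bool (p n)))"
proof -
  have "total_recursive (\<lambda>p m. if psnd m < pfst m then Suc (of_bool (p (psnd m))) else 0)"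
    by (intro recursive_intros)
  then show ?thesis by (auto simp: approximates_def)
qed

lemma approximates_pair:
  assumes F: "approximates TF F" and G: "approximates TG G"
  shows "approximates
    (\<lambda>p s n. if TF p s n = 0 \<or> TG p s n = 0 then 0
       else Suc (prod_encode (TF p s n - 1, TG p s n - 1)))
    (\<lambda>p n. Option.bind (F p n) (\<lambda>a. Option.bind (G p n) (\<lambda>b. Some (prod_encode (a, b)))))"
    (is "approximates ?T ?H")
  unfolding approximates_def
proof (intro conjI allI impI)
  show "total_recursive (\<lambda>p m. ?T p (pfst m) (psnd m))"
    by (intro recursive_intros approximatesD(1)[OF F] approximatesD(1)[OF G])
next
  fix p n v
  show "?H p n = Some v \<longleftrightarrow> (\<exists>s. ?T p s n = Suc v)"
  proof
    assume "?H p n = Some v"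
    then obtain a b where ab: "F p n = Some a" "G p n = Some b" "v = prod_encode (a, b)"
      by (auto simp: Option.bind_eq_Some_conv)
    then obtain s s' where "TF p s n = Suc a" "TG p s' n = Suc b"
      using approximatesD(2)[OF F] approximatesD(2)[OF G] by blast
    then have "TF p (max s s') n = Suc a" "TG p (max s s') n = Suc b"
      using approximatesD(3)[OF F] approximatesD(3)[OF G] by (meson max.cobounded1 max.cobounded2)+
    then have "?T p (max s s') n = Suc v" using ab by simp
    then show "\<exists>s. ?T p s n = Suc v" by blast
  next
    assume "\<exists>s. ?T p s n = Suc v"
    then obtain s where s: "?T p s n = Suc v" ..
    then have "TF p s n \<noteq> 0" "TG p s n \<noteq> 0" by (auto split: if_splits)
    then obtain a b where "TF p s n = Suc a" "TG p s n = Suc b"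
      by (meson not0_implies_Suc)
    moreover from this s have "v = prod_encode (a, b)" by simp
    moreover from calculation have "F p n = Some a" "G p n = Some b"
      using approximatesD(2)[OF F] approximatesD(2)[OF G] by blast+
    ultimately show "?H p n = Some v" by simp
  qed
next
  fix p s s' n v
  assume *: "?T p s n = Suc v" "s \<le> s'"
  then have "TF p s n \<noteq> 0" "TG p s n \<noteq> 0" by (auto split: if_splits)
  then obtain a b where ab: "TF p s n = Suc a" "TG p s n = Suc b"
    by (meson not0_implies_Suc)
  with * have "TF p s' n = Suc a" "TG p s' n = Suc b"
    using approximatesD(3)[OF F] approximatesD(3)[OF G] by blast+
  with * ab show "?T p s' n = Suc v" by simp
next
  fix p p' :: cantor and s n
  assume "\<forall>i<s. p i = p' i"
  then show "?T p s n = ?T p' s n"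
    using approximatesD(4)[OF F, of s p p'] approximatesD(4)[OF G, of s p p'] by simp
qed

lemma approximates_comp:
  assumes F: "approximates TF F" and G: "approximates TG G"
  shows "approximates (\<lambda>p s n. if TG p s n = 0 then 0 else TF p s (TG p s n - 1))
    (\<lambda>p n. Option.bind (G p n) (F p))" (is "approximates ?T ?H")
  unfolding approximates_def
proof (intro conjI allI impI)
  show "total_recursive (\<lambda>p m. ?T p (pfst m) (psnd m))"
    by (intro recursive_intros approximatesD(1)[OF F] approximatesD(1)[OF G])
next
  fix p n v
  show "?H p n = Some v \<longleftrightarrow> (\<exists>s. ?T p s n = Suc v)"
  proof
    assume "?H p n = Some v"
    then obtain a where ab: "G p n = Some a" "F p a = Some v"
      by (auto simp: Option.bind_eq_Some_conv)
    then obtain s s' where "TG p s n = Suc a" "TF p s' a = Suc v"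
      using approximatesD(2)[OF F] approximatesD(2)[OF G] by blast
    then have "TG p (max s s') n = Suc a" "TF p (max s s') a = Suc v"
      using approximatesD(3)[OF F] approximatesD(3)[OF G] by (meson max.cobounded1 max.cobounded2)+
    then have "?T p (max s s') n = Suc v" by simp
    then show "\<exists>s. ?T p s n = Suc v" by blast
  next
    assume "\<exists>s. ?T p s n = Suc v"
    then obtain s where s: "?T p s n = Suc v" ..
    then have "TG p s n \<noteq> 0" by (auto split: if_splits)
    then obtain a where "TG p s n = Suc a" by (meson not0_implies_Suc)
    moreover from this s have "TF p s a = Suc v" by simp
    ultimately have "G p n = Some a" "F p a = Some v"
      using approximatesD(2)[OF F] approximatesD(2)[OF G] by blast+
    then show "?H p n = Some v" by simp
  qed
next
  fix p s s' n v
  assume *: "?T p s n = Suc v" "s \<le> s'"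
  then have "TG p s n \<noteq> 0" by (auto split: if_splits)
  then obtain a where a: "TG p s n = Suc a" by (meson not0_implies_Suc)
  with *(1) have "TF p s a = Suc v" by simp
  from approximatesD(3)[OF F this *(2)] approximatesD(3)[OF G a *(2)]
  show "?T p s' n = Suc v" by simp
next
  fix p p' :: cantor and s n
  assume "\<forall>i<s. p i = p' i"
  then show "?T p s n = ?T p' s n"
    using approximatesD(4)[OF F, of s p p'] approximatesD(4)[OF G, of s p p'] by simp
qed

text \<open>All steps of the recursion run with the same number of stages. A recursion uses finitely
  many values, so by monotonicity one large stage settles them all.\<close>

lemma approximates_prec:
  assumes F: "approximates TF F" and G: "approximates TG G"
  shows "approximates
    (\<lambda>p s n. rec_nat (TF p s (pfst n))
      (\<lambda>i r. if r = 0 then 0 else TG p s (prod_encode (pfst n, prod_encode (i, r - 1)))) (psnd n))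
    (\<lambda>p n. case prod_decode n of (a, k) \<Rightarrow>
      rec_nat (F p a)
        (\<lambda>i r. Option.bind r (\<lambda>v. G p (prod_encode (a, prod_encode (i, v))))) k)"
proof -
  define T where "T = (\<lambda>p s a k. rec_nat (TF p s a)
      (\<lambda>i r. if r = 0 then 0 else TG p s (prod_encode (a, prod_encode (i, r - 1)))) k)"
  define H where "H = (\<lambda>p a k. rec_nat (F p a)
        (\<lambda>i r. Option.bind r (\<lambda>v. G p (prod_encode (a, prod_encode (i, v))))) k)"
  have T_Suc: "\<exists>u. T p s a k = Suc u \<and> TG p s (prod_encode (a, prod_encode (k, u))) = Suc v"
    if "T p s a (Suc k) = Suc v" for p s a k v
    using that by (cases "T p s a k") (auto simp: T_def)
  have mono: "T p s a k = Suc v \<Longrightarrow> s \<le> s' \<Longrightarrow> T p s' a k = Suc v" for p s s' a k v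
  proof (induction k arbitrary: v)
    case 0
    then show ?case unfolding T_def old.nat.simps(6) by (rule approximatesD(3)[OF F])
  next
    case (Suc k)
    then obtain u where "T p s a k = Suc u" "TG p s (prod_encode (a, prod_encode (k, u))) = Suc v"
      using T_Suc by blast
    with Suc have "T p s' a k = Suc u" "TG p s' (prod_encode (a, prod_encode (k, u))) = Suc v"
      using approximatesD(3)[OF G] by blast+
    then show ?case by (simp add: T_def)
  qed
  have lim: "H p a k = Some v \<longleftrightarrow> (\<exists>s. T p s a k = Suc v)" for p a k v
  proof (induction k arbitrary: v)
    case 0
    show ?case unfolding T_def H_def old.nat.simps(6) by (rule approximatesD(2)[OF F])
  next
    case (Suc k)
    show ?case
    proof
      assume "H p a (Suc k) = Some v"
      then obtain u where "H p a k = Some u" "G p (prod_encode (a, prod_encode (k, u))) = Some v"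
        by (auto simp: H_def Option.bind_eq_Some_conv)
      then obtain s s' where "T p s a k = Suc u"
          "TG p s' (prod_encode (a, prod_encode (k, u))) = Suc v"
        using Suc approximatesD(2)[OF G] by blast
      then have "T p (max s s') a k = Suc u"
          "TG p (max s s') (prod_encode (a, prod_encode (k, u))) = Suc v"
        using mono approximatesD(3)[OF G] by (meson max.cobounded1 max.cobounded2)+
      then have "T p (max s s') a (Suc k) = Suc v" by (simp add: T_def)
      then show "\<exists>s. T p s a (Suc k) = Suc v" by blast
    next
      assume "\<exists>s. T p s a (Suc k) = Suc v"
      then obtain s u where "T p s a k = Suc u"
          "TG p s (prod_encode (a, prod_encode (k, u))) = Suc v"
        using T_Suc by blast
      then have "H p a k = Some u" "G p (prod_encode (a, prod_encode (k, u))) = Some v"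
        using Suc approximatesD(2)[OF G] by blast+
      then show "H p a (Suc k) = Some v" by (simp add: H_def)
    qed
  qed
  have use: "T p s a k = T p' s a k" if "\<forall>i<s. p i = p' i" for p p' s a k
  proof -
    have "TF p s = TF p' s" "TG p s = TG p' s"
      using approximatesD(4)[OF F, of s p p'] approximatesD(4)[OF G, of s p p'] that by auto
    then show ?thesis by (simp only: T_def)
  qed
  have "total_recursive (\<lambda>p m. T p (pfst m) (pfst (psnd m)) (psnd (psnd m)))"
    unfolding T_def
    by (intro recursive_intros approximatesD(1)[OF F] approximatesD(1)[OF G])
  then have "approximates (\<lambda>p s n. T p s (pfst n) (psnd n)) (\<lambda>p n. H p (pfst n) (psnd n))"
    unfolding approximates_def
    by (intro conjI allI impI) (assumption | rule lim | erule (1) mono | erule use)+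
  then show ?thesis by (simp add: T_def H_def case_prod_beta)
qed

text \<open>Stage \<open>s\<close> searches below \<open>s\<close> and demands that all values
  before the zero have been found, so no later stage reveals an earlier zero. The result 1 stands
  for the value 0. The alternative \<open>k = s\<close> makes the minimization total without
  affecting a successful search.\<close>

lemma approximates_mu:
  assumes F: "approximates TF F"
  shows "approximates
    (\<lambda>p s n. if \<exists>k<s. TF p s (prod_encode (n, k)) = 1 \<and> (\<forall>j<k. TF p s (prod_encode (n, j)) \<noteq> 0)
      then Suc (LEAST k. TF p s (prod_encode (n, k)) = 1 \<or> k = s) else 0)
    (\<lambda>p n.
      if \<exists>k. F p (prod_encode (n, k)) = Some 0 \<and> (\<forall>j<k. F p (prod_encode (n, j)) \<noteq> None)
      then Some (LEAST k. F p (prod_encode (n, k)) = Some 0)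
      else None)" (is "approximates ?T ?H")
proof -
  have T_iff: "?T p s n = Suc v \<longleftrightarrow> v < s \<and> TF p s (prod_encode (n, v)) = 1 \<and>
      (\<forall>j<v. TF p s (prod_encode (n, j)) > 1)" (is "_ \<longleftrightarrow> ?R v") for p s n v
  proof -
    have least: "(LEAST k. TF p s (prod_encode (n, k)) = 1 \<or> k = s) = k"
      if "?R k" for k
      using that by (intro Least_equality) (auto intro: leI)
    have ex: "\<exists>k. ?R k" if "k < s" "TF p s (prod_encode (n, k)) = 1"
        "\<forall>j<k. TF p s (prod_encode (n, j)) \<noteq> 0" for k
    proof -
      define l where "l = (LEAST k. TF p s (prod_encode (n, k)) = 1)"
      have "l \<le> k" unfolding l_def using that(2) by (rule Least_le)
      moreover have "TF p s (prod_encode (n, l)) = 1"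
        unfolding l_def using that(2) by (rule LeastI)
      moreover have "TF p s (prod_encode (n, j)) \<noteq> 1" if "j < l" for j
        using that not_less_Least unfolding l_def by blast
      ultimately have "?R l" using that(1,3)
        by (metis One_nat_def Suc_lessI not_gr_zero order_less_le_trans order_le_less_trans)
      then show ?thesis ..
    qed
    show ?thesis
    proof
      assume *: "?T p s n = Suc v"
      then obtain k where "?R k" using ex by (auto split: if_splits)
      with least[OF this] * show "?R v" by (auto split: if_splits)
    next
      assume "?R v"
      with least[OF this] show "?T p s n = Suc v" by force
    qed
  qed
  have H_iff: "?H p n = Some v \<longleftrightarrow> F p (prod_encode (n, v)) = Some 0 \<and>
      (\<forall>j<v. \<exists>u. F p (prod_encode (n, j)) = Some (Suc u))" (is "_ \<longleftrightarrow> ?Q v") for p n v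
  proof -
    have least: "(LEAST k. F p (prod_encode (n, k)) = Some 0) = k" if "?Q k" for k
      using that by (intro Least_equality) (auto intro!: leI)
    have ex: "\<exists>k. ?Q k" if "F p (prod_encode (n, k)) = Some 0"
        "\<forall>j<k. F p (prod_encode (n, j)) \<noteq> None" for k
    proof -
      define l where "l = (LEAST k. F p (prod_encode (n, k)) = Some 0)"
      have "l \<le> k" unfolding l_def using that(1) by (rule Least_le)
      moreover have "F p (prod_encode (n, l)) = Some 0"
        unfolding l_def using that(1) by (rule LeastI)
      moreover have "F p (prod_encode (n, j)) \<noteq> Some 0" if "j < l" for j
        using that not_less_Least unfolding l_def by blast
      ultimately have "?Q l" using that(2)
        by (metis not0_implies_Suc not_None_eq order_less_le_trans)
      then show ?thesis ..
    qed
    show ?thesis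
    proof
      assume *: "?H p n = Some v"
      then obtain k where "?Q k" using ex by (auto split: if_splits)
      with least[OF this] * show "?Q v" by (auto split: if_splits)
    next
      assume "?Q v"
      with least[OF this] show "?H p n = Some v" by force
    qed
  qed
  show ?thesis
    unfolding approximates_def
  proof (intro conjI)
    have "total_recursive (\<lambda>p m. LEAST k. TF p (pfst m) (prod_encode (psnd m, k)) = 1 \<or> k = pfst m)"
    proof (rule total_recursive_Least)
      show "decidable (\<lambda>p m. TF p (pfst (pfst m)) (prod_encode (psnd (pfst m), psnd m)) = 1 \<or>
          psnd m = pfst (pfst m))"
        by (intro recursive_intros approximatesD(1)[OF F])
    qed blast
    then show "total_recursive (\<lambda>p m. ?T p (pfst m) (psnd m))"
      by (intro recursive_intros approximatesD(1)[OF F])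
  next
    show "\<forall>p s s' n v. ?T p s n = Suc v \<longrightarrow> s \<le> s' \<longrightarrow> ?T p s' n = Suc v"
      unfolding T_iff
    proof (intro allI impI, elim conjE, intro conjI allI impI)
      fix p s s' n v j
      assume *: "s \<le> s'" "v < s" "TF p s (prod_encode (n, v)) = 1"
        "\<forall>j<v. 1 < TF p s (prod_encode (n, j))"
      show "v < s'" using * by simp
      show "TF p s' (prod_encode (n, v)) = 1"
        using approximatesD(3)[OF F, of p s "prod_encode (n, v)" 0 s'] * by simp
      assume "j < v"
      then have "1 < TF p s (prod_encode (n, j))" using * by simp
      moreover from this have "TF p s' (prod_encode (n, j)) = TF p s (prod_encode (n, j))"
        using approximatesD(3)[OF F _ *(1), of p "prod_encode (n, j)" "TF p s (prod_encode (n, j)) - 1"]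
        by simp
      ultimately show "1 < TF p s' (prod_encode (n, j))" by simp
    qed
  next
    show "\<forall>p p' s n. (\<forall>i<s. p i = p' i) \<longrightarrow> ?T p s n = ?T p' s n"
    proof (intro allI impI)
      fix p p' :: cantor and s n
      assume "\<forall>i<s. p i = p' i"
      then have "TF p s = TF p' s" using approximatesD(4)[OF F, of s p p'] by auto
      then show "?T p s n = ?T p' s n" by (simp only:)
    qed
  next
    show "\<forall>p n v. ?H p n = Some v \<longleftrightarrow> (\<exists>s. ?T p s n = Suc v)"
      unfolding T_iff H_iff
    proof (intro allI iffI)
      fix p n v
      assume *: "F p (prod_encode (n, v)) = Some 0 \<and>
        (\<forall>j<v. \<exists>u. F p (prod_encode (n, j)) = Some (Suc u))"
      then obtain s0 where s0: "TF p s0 (prod_encode (n, v)) = Suc 0"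
        using approximatesD(2)[OF F] by blast
      have "\<forall>j<v. \<exists>s. \<exists>u. TF p s (prod_encode (n, j)) = Suc (Suc u)"
        using * approximatesD(2)[OF F] by blast
      then obtain f where f: "\<And>j. j < v \<Longrightarrow> \<exists>u. TF p (f j) (prod_encode (n, j)) = Suc (Suc u)"
        by metis
      \<comment> \<open>A stage beyond \<open>v\<close> itself and beyond all stages at which the
        finitely many values up to \<open>v\<close> are found.\<close>
      define s where "s = Suc v + s0 + sum f {..<v}"
      have fs: "f j \<le> s" if "j < v" for j
        using member_le_sum[of j "{..<v}" f] that by (simp add: s_def)
      have "\<forall>j<v. 1 < TF p s (prod_encode (n, j))"
      proof (intro allI impI)
        fix j assume j: "j < v"
        from f[OF this] obtain u where "TF p (f j) (prod_encode (n, j)) = Suc (Suc u)" ..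
        from approximatesD(3)[OF F this fs[OF j]]
        show "1 < TF p s (prod_encode (n, j))" by simp
      qed
      moreover have "TF p s (prod_encode (n, v)) = 1"
        using approximatesD(3)[OF F s0, of s] by (simp add: s_def)
      ultimately show "\<exists>s>v. TF p s (prod_encode (n, v)) = 1 \<and>
          (\<forall>j<v. 1 < TF p s (prod_encode (n, j)))"
        by (intro exI[of _ s]) (simp add: s_def)
    next
      fix p n v
      assume "\<exists>s>v. TF p s (prod_encode (n, v)) = 1 \<and> (\<forall>j<v. 1 < TF p s (prod_encode (n, j)))"
      then obtain s where "s > v \<and> TF p s (prod_encode (n, v)) = 1 \<and>
          (\<forall>j<v. 1 < TF p s (prod_encode (n, j)))" ..
      then have s: "TF p s (prod_encode (n, v)) = 1"
        "j < v \<Longrightarrow> 1 < TF p s (prod_encode (n, j))" for j by simp_all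
      have "\<exists>u. F p (prod_encode (n, j)) = Some (Suc u)" if "j < v" for j
      proof -
        have "TF p s (prod_encode (n, j)) = Suc (Suc (TF p s (prod_encode (n, j)) - 2))"
          using s(2)[OF that] by simp
        then show ?thesis using approximatesD(2)[OF F] by blast
      qed
      moreover have "F p (prod_encode (n, v)) = Some 0"
        unfolding approximatesD(2)[OF F] using s(1) by auto
      ultimately show "F p (prod_encode (n, v)) = Some 0 \<and>
        (\<forall>j<v. \<exists>u. F p (prod_encode (n, j)) = Some (Suc u))"
        by blast
    qed
  qed
qed

lemma partial_recursive_approximable:
  assumes "partial_recursive F"
  shows "\<exists>T. approximates T F"
  using assms
proof induction
  case zero
  show ?case by (rule exI, rule approximates_total) (intro recursive_intros refl)+
next
  case succ
  show ?case by (rule exI, rule approximates_total) (intro recursive_intros refl)+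
next
  case left
  show ?case by (rule exI, rule approximates_total) (intro recursive_intros refl)+
next
  case right
  show ?case by (rule exI, rule approximates_total) (intro recursive_intros refl)+
next
  case query
  show ?case by (rule exI, rule approximates_query)
next
  case (pair F G)
  then show ?case by (elim exE) (rule exI, rule approximates_pair)
next
  case (comp F G)
  then show ?case by (elim exE) (rule exI, rule approximates_comp)
next
  case (prec F G)
  then show ?case by (elim exE) (rule exI, rule approximates_prec)
next
  case (mu F)
  then show ?case by (elim exE) (rule exI, rule approximates_mu)
qed

section \<open>Names of open and closed sets\<close>

definition word_drop :: "nat \<Rightarrow> nat \<Rightarrow> nat" where
  "word_drop w k = rec_nat w (\<lambda>_ v. psnd (v - 1)) k"

definition word_length :: "nat \<Rightarrow> nat" where
  "word_length w = (LEAST k. word_drop w k = 0)"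

text \<open>The code of a 0-1 word yields the word continued by zeros, which can serve as an
  oracle.\<close>

definition word_bit :: "nat \<Rightarrow> cantor" where
  "word_bit w i \<longleftrightarrow> pfst (word_drop w i - 1) = 1"

lemma word_drop_list_encode: "word_drop (list_encode xs) k = list_encode (drop k xs)"
proof (induction k)
  case 0
  show ?case by (simp add: word_drop_def)
next
  case (Suc k)
  \<comment> \<open>The operation \<open>psnd (v - 1)\<close> takes the tail of a nonempty list;
    since 0 codes the pair (0, 0), it also fixes the code 0 of the empty list.\<close>
  have "prod_decode 0 = (0, 0)"
    using prod_encode_inverse[of "(0, 0)"] by (simp add: prod_encode_def)
  then have "psnd (list_encode ys - 1) = list_encode (tl ys)" for ys
    by (cases ys) simp_all
  with Suc show ?case by (simp add: word_drop_def tl_drop drop_Suc)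
qed

lemma list_encode_eq_0_iff: "list_encode xs = 0 \<longleftrightarrow> xs = []"
  by (cases xs) simp_all

lemma word_length_list_encode: "word_length (list_encode xs) = length xs"
  unfolding word_length_def word_drop_list_encode list_encode_eq_0_iff
  by (rule Least_equality) simp_all

lemma word_length_word_code [simp]: "word_length (word_code x n) = n"
  by (simp add: word_code_def word_length_list_encode)

lemma word_bit_word_code:
  assumes "i < n"
  shows "word_bit (word_code x n) i = x i"
proof -
  have "drop i (map f [0..<n]) = f i # map f [Suc i..<n]" for f :: "nat \<Rightarrow> nat"
    using upt_conv_Cons[OF assms] by (simp add: drop_map del: upt_Suc)
  then show ?thesis
    by (simp add: word_bit_def word_code_def word_drop_list_encode)
qed

lemma total_recursive_word_drop [recursive_intros]:
  "total_recursive a \<Longrightarrow> total_recursive b \<Longrightarrow> total_recursive (\<lambda>p n. word_drop (a p n) (b p n))"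
  unfolding word_drop_def by (intro recursive_intros)

lemma total_recursive_word_length [recursive_intros]:
  assumes "total_recursive a"
  shows "total_recursive (\<lambda>p n. word_length (a p n))"
  unfolding word_length_def
proof (rule total_recursive_Least)
  show "decidable (\<lambda>p m. word_drop (a p (pfst m)) (psnd m) = 0)"
    by (intro recursive_intros total_recursive_comp[OF assms])
  have "word_drop (list_encode xs) (length xs) = 0" for xs
    by (simp add: word_drop_list_encode)
  then show "\<exists>k. word_drop (a p n) k = 0" for p n
    by (metis list_decode_inverse)
qed

lemma decidable_word_bit [recursive_intros]:
  "total_recursive a \<Longrightarrow> total_recursive b \<Longrightarrow> decidable (\<lambda>p n. word_bit (a p n) (b p n))"
  unfolding word_bit_def by (intro recursive_intros)

section \<open>From names to membership in open and closed sets\<close>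

lemma cantor_app_eq_Some_iff:
  "cantor_app p q = Some r \<longleftrightarrow>
     (\<forall>n b. r n = b \<longleftrightarrow> (\<exists>k. p (prod_encode (word_code q k, prod_encode (n, of_bool b)))))"
  (is "_ \<longleftrightarrow> ?P r")
proof -
  have "z = r" if "?P z" "?P r" for z
    using that by blast
  then show ?thesis unfolding cantor_app_def the_opt_eq_Some_iff by blast
qed

lemma open_rep_eq_Some_iff:
  "open_rep \<delta> p = Some U \<longleftrightarrow> U \<subseteq> ran \<delta> \<and>
     (\<forall>x \<xi>. \<delta> x = Some \<xi> \<longrightarrow> (\<exists>r. cantor_app p x = Some r \<and> ((\<exists>n. r n) \<longleftrightarrow> \<xi> \<in> U)))"
  (is "?L \<longleftrightarrow> ?R")
proof
  assume ?L
  then obtain f where f: "fun_rep \<delta> sierpinski_rep p = Some f" and U: "U = {x \<in> ran \<delta>. f x}"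
    by (auto simp: open_rep_def)
  have "\<exists>r. cantor_app p x = Some r \<and> ((\<exists>n. r n) \<longleftrightarrow> \<xi> \<in> U)" if "\<delta> x = Some \<xi>" for x \<xi>
  proof -
    from f that obtain r where "cantor_app p x = Some r" "sierpinski_rep r = Some (f \<xi>)"
      unfolding fun_rep_eq_Some_iff realizes_def by blast
    then show ?thesis using ranI[of \<delta>, OF that] by (auto simp: sierpinski_rep_def U)
  qed
  then show ?R using U by blast
next
  assume R: ?R
  have "fun_rep \<delta> sierpinski_rep p = Some (restrict (\<lambda>x. x \<in> U) (ran \<delta>))"
    unfolding fun_rep_eq_Some_iff realizes_def
  proof (intro conjI allI impI)
    fix x \<xi>
    assume "\<delta> x = Some \<xi> \<and> {restrict (\<lambda>x. x \<in> U) (ran \<delta>) \<xi>} \<noteq> {}"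
    then have x: "\<delta> x = Some \<xi>" by blast
    then obtain r where "cantor_app p x = Some r" "(\<exists>n. r n) \<longleftrightarrow> \<xi> \<in> U" using R by blast
    with x show "\<exists>q y. cantor_app p x = Some q \<and> sierpinski_rep q = Some y \<and>
        y \<in> {restrict (\<lambda>x. x \<in> U) (ran \<delta>) \<xi>}"
      by (simp add: sierpinski_rep_def ranI)
  qed simp
  moreover have "{x \<in> ran \<delta>. restrict (\<lambda>x. x \<in> U) (ran \<delta>) x} = U" using R by auto
  ultimately show ?L by (simp add: open_rep_def)
qed

lemma closed_rep_eq_Some_iff:
  "closed_rep \<delta> p = Some A \<longleftrightarrow> A \<subseteq> ran \<delta> \<and>
     (\<forall>x \<xi>. \<delta> x = Some \<xi> \<longrightarrow> (\<exists>r. cantor_app p x = Some r \<and> ((\<exists>n. r n) \<longleftrightarrow> \<xi> \<notin> A)))"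
proof -
  have "closed_rep \<delta> p = Some A \<longleftrightarrow> A \<subseteq> ran \<delta> \<and> open_rep \<delta> p = Some (ran \<delta> - A)"
  proof
    assume "closed_rep \<delta> p = Some A"
    then obtain U where U: "open_rep \<delta> p = Some U" "A = ran \<delta> - U" by (auto simp: closed_rep_def)
    moreover have "U \<subseteq> ran \<delta>" using U(1) by (simp add: open_rep_eq_Some_iff)
    ultimately show "A \<subseteq> ran \<delta> \<and> open_rep \<delta> p = Some (ran \<delta> - A)"
      by (simp add: double_diff)
  qed (auto simp: closed_rep_def double_diff)
  then show ?thesis
    unfolding open_rep_eq_Some_iff by (auto simp: ranI)
qed

text \<open>All triples asserting an output bit 0: the function named is constantly zero, so no
  point is ever reported to lie outside the closed set.\<close>

definition full_name :: cantor where
  "full_name j \<longleftrightarrow> psnd (psnd j) = 0"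

lemma closed_rep_full_name: "closed_rep \<delta> full_name = Some (ran \<delta>)"
proof -
  have "cantor_app full_name x = Some (\<lambda>_. False)" for x
    by (auto simp: cantor_app_eq_Some_iff full_name_def)
  then show ?thesis by (auto simp: closed_rep_eq_Some_iff ranI)
qed

text \<open>\<open>ver x s m\<close> stands for: within \<open>s\<close> stages the point named
  \<open>x\<close> has been seen to lie in \<open>B m\<close>. The bound on the bits read allows an
  evaluation on finite words.\<close>

locale effective_subbase =
  fixes \<delta> :: "'a rep" and B :: "nat \<Rightarrow> 'a set" and ver :: "cantor \<Rightarrow> nat \<Rightarrow> nat \<Rightarrow> bool"
  assumes decidable_ver0: "decidable (\<lambda>p m. ver p (pfst m) (psnd m))"
    and ver_use: "(\<And>i. i < s \<Longrightarrow> p i = p' i) \<Longrightarrow> ver p s m = ver p' s m"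
    and ver_mono: "ver p s m \<Longrightarrow> s \<le> s' \<Longrightarrow> ver p s' m"
    and mem_B_iff: "\<delta> x = Some \<xi> \<Longrightarrow> \<xi> \<in> B m \<longleftrightarrow> (\<exists>s. ver x s m)"
begin

section \<open>Removing open sets from a closed set\<close>

definition basic :: "nat \<Rightarrow> 'a set" where
  "basic e = {\<xi> \<in> ran \<delta>. \<forall>m \<in> set_decode e. \<xi> \<in> B m}"

text \<open>The second argument of \<open>R\<close> is a witness, so that a decidable
  \<open>R\<close> can describe a family of basic sets that is merely enumerable.\<close>

definition acc :: "(nat \<Rightarrow> nat \<Rightarrow> bool) \<Rightarrow> cantor \<Rightarrow> nat \<Rightarrow> bool" where
  "acc R x n \<longleftrightarrow> (\<exists>e<n. \<exists>i<n. R e i \<and> (\<forall>m \<in> set_decode e. ver x n m))"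

text \<open>
  If \<open>p\<close> names the closed set \<open>A\<close>, then \<open>diff_name p R\<close> names \<open>A\<close> minus all \<open>basic e\<close> with \<open>R e i\<close> for
  some \<open>i\<close>: even output bits come from \<open>p\<close>, and odd output bits report whether the input has been
  seen to lie in the removed open set.
\<close>

definition diff_name :: "cantor \<Rightarrow> (nat \<Rightarrow> nat \<Rightarrow> bool) \<Rightarrow> cantor" where
  "diff_name p R j \<longleftrightarrow>
     (if even (pfst (psnd j))
      then p (prod_encode (pfst j, prod_encode (pfst (psnd j) div 2, psnd (psnd j))))
      else word_length (pfst j) = pfst (psnd j) div 2 \<and>
        psnd (psnd j) = of_bool (acc R (word_bit (pfst j)) (pfst (psnd j) div 2)))"

lemma acc_word_code: "acc R (word_bit (word_code x n)) n = acc R x n"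
proof -
  have "ver (word_bit (word_code x n)) n m = ver x n m" for m
    by (rule ver_use) (rule word_bit_word_code)
  then show ?thesis by (simp add: acc_def)
qed

text \<open>The odd bit \<open>2 * k + 1\<close> is asserted by the prefix of length
  \<open>k\<close> only, and that prefix determines its value because \<open>k\<close> stages read
  at most \<open>k\<close> bits. Hence no two triples contradict each other.\<close>

lemma cantor_app_diff_name:
  assumes "cantor_app p x = Some r"
  shows "cantor_app (diff_name p R) x =
    Some (\<lambda>m. if even m then r (m div 2) else acc R x (m div 2))"
  unfolding cantor_app_eq_Some_iff
proof (intro allI)
  fix n b
  show "((if even n then r (n div 2) else acc R x (n div 2)) = b) \<longleftrightarrow>
    (\<exists>k. diff_name p R (prod_encode (word_code x k, prod_encode (n, of_bool b))))"
  proof (cases "even n")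
    case True
    then show ?thesis using assms by (simp add: diff_name_def cantor_app_eq_Some_iff)
  next
    case False
    then show ?thesis by (auto simp: diff_name_def acc_word_code of_bool_eq_iff)
  qed
qed

lemma ex_acc_iff:
  assumes "\<delta> x = Some \<xi>"
  shows "(\<exists>n. acc R x n) \<longleftrightarrow> (\<exists>e i. R e i \<and> \<xi> \<in> basic e)"
proof
  assume "\<exists>n. acc R x n"
  then show "\<exists>e i. R e i \<and> \<xi> \<in> basic e"
    using assms by (auto simp: acc_def basic_def mem_B_iff intro: ranI)
next
  assume "\<exists>e i. R e i \<and> \<xi> \<in> basic e"
  then obtain e i where e: "R e i" "\<xi> \<in> basic e" by blast
  then have "\<forall>m \<in> set_decode e. \<exists>s. ver x s m" using mem_B_iff[OF assms] by (simp add: basic_def)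
  then obtain f where f: "\<And>m. m \<in> set_decode e \<Longrightarrow> ver x (f m) m" by metis
  \<comment> \<open>Large enough for \<open>e\<close>, for the witness \<open>i\<close> and for all
    stages verifying the finitely many memberships.\<close>
  define n where "n = Suc e + Suc i + sum f (set_decode e)"
  have "f m \<le> n" if "m \<in> set_decode e" for m
    using member_le_sum[of m "set_decode e" f] that by (simp add: n_def)
  then have "ver x n m" if "m \<in> set_decode e" for m
    using ver_mono[OF f] that by blast
  moreover have "e < n" "i < n" by (simp_all add: n_def)
  ultimately show "\<exists>n. acc R x n" using e(1) unfolding acc_def by blast
qed

lemma closed_rep_diff_name:
  assumes "closed_rep \<delta> p = Some A"
  shows "closed_rep \<delta> (diff_name p R) = Some {\<xi> \<in> A. \<not> (\<exists>e i. R e i \<and> \<xi> \<in> basic e)}"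
  unfolding closed_rep_eq_Some_iff
proof (intro conjI allI impI)
  show "{\<xi> \<in> A. \<not> (\<exists>e i. R e i \<and> \<xi> \<in> basic e)} \<subseteq> ran \<delta>"
    using assms by (auto simp: closed_rep_eq_Some_iff)
  fix x \<xi>
  assume x: "\<delta> x = Some \<xi>"
  with assms obtain r where r: "cantor_app p x = Some r" "(\<exists>n. r n) \<longleftrightarrow> \<xi> \<notin> A"
    unfolding closed_rep_eq_Some_iff by blast
  let ?r = "\<lambda>m. if even m then r (m div 2) else acc R x (m div 2)"
  have "?r (2 * n) = r n" "?r (2 * n + 1) = acc R x n" for n by simp_all
  then have "(\<exists>m. ?r m) \<longleftrightarrow> (\<exists>n. r n) \<or> (\<exists>n. acc R x n)" by meson
  with r(2) ex_acc_iff[OF x]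
  have "(\<exists>m. ?r m) \<longleftrightarrow> \<xi> \<notin> {\<xi> \<in> A. \<not> (\<exists>e i. R e i \<and> \<xi> \<in> basic e)}" by simp
  with cantor_app_diff_name[OF r(1), of R]
  show "\<exists>r. cantor_app (diff_name p R) x = Some r \<and>
      ((\<exists>n. r n) \<longleftrightarrow> \<xi> \<notin> {\<xi> \<in> A. \<not> (\<exists>e i. R e i \<and> \<xi> \<in> basic e)})" by blast
qed

lemma decidable_diff_name:
  assumes Q: "decidable (\<lambda>p m. Q p (pfst m) (psnd m))"
    and R: "decidable (\<lambda>p m. R p (pfst m) (pfst (psnd m)) (psnd (psnd m)))"
    and a: "total_recursive a"
  shows "decidable (\<lambda>p n. diff_name (Q p n) (R p n) (a p n))"
proof -
  \<comment> \<open>Here \<open>ver\<close> runs on a word extracted from the index instead of the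
    given oracle, which calls for oracle substitution.\<close>
  have ver: "decidable (\<lambda>p n. ver (word_bit (b p n)) (c p n) (d p n))"
    if [recursive_intros]: "total_recursive b" "total_recursive c" "total_recursive d" for b c d
  proof -
    have "decidable (\<lambda>p n. ver (word_bit (b p n)) (pfst (prod_encode (c p n, d p n)))
        (psnd (prod_encode (c p n, d p n))))"
      by (rule decidable_substitute_oracle[OF decidable_ver0])
        (intro recursive_intros total_recursive_comp[OF that(1)])+
    then show ?thesis by simp
  qed
  show ?thesis
    unfolding diff_name_def acc_def
    by (intro recursive_intros ver decidable_comp2[OF Q] decidable_comp3[OF R] total_recursive_comp[OF a] a)
qed

end

section \<open>Cover tests from computable compactness\<close>

locale effectively_compact_subbase = effective_subbase \<delta> B ver
  for \<delta> :: "'a rep" and B ver +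
  fixes K :: "cantor \<Rightarrow> nat \<Rightarrow> nat \<Rightarrow> nat" and \<Phi> :: "cantor \<Rightarrow> nat \<Rightarrow> nat option"
  assumes K_approximates: "approximates K \<Phi>"
    and \<Phi>_empty_iff: "closed_rep \<delta> p = Some A \<Longrightarrow> (\<exists>n. \<Phi> p n = Some 1) \<longleftrightarrow> A = {}"
begin

text \<open>The emptiness test, run for \<open>k\<close> stages on the set that remains after the
  removal, has answered yes: \<open>Suc 1\<close> is the output bit 1 in the encoding of
  \<open>approximates\<close>.\<close>

definition covered :: "cantor \<Rightarrow> (nat \<Rightarrow> nat \<Rightarrow> bool) \<Rightarrow> nat \<Rightarrow> bool" where
  "covered p R k \<longleftrightarrow> (\<exists>n<k. K (diff_name p R) k n = Suc 1)"

lemma covered_mono: "covered p R k \<Longrightarrow> k \<le> k' \<Longrightarrow> covered p R k'"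
  unfolding covered_def
  using approximatesD(3)[OF K_approximates, of "diff_name p R" k _ 1 k']
  by (meson order_less_le_trans)

lemma ex_covered_iff:
  assumes "closed_rep \<delta> p = Some A"
  shows "(\<exists>k. covered p R k) \<longleftrightarrow> (\<forall>\<xi> \<in> A. \<exists>e i. R e i \<and> \<xi> \<in> basic e)"
proof -
  have "(\<exists>k. covered p R k) \<longleftrightarrow> (\<exists>n. \<Phi> (diff_name p R) n = Some 1)"
  proof
    assume "\<exists>k. covered p R k"
    then obtain k n where "K (diff_name p R) k n = Suc 1" by (auto simp: covered_def)
    then show "\<exists>n. \<Phi> (diff_name p R) n = Some 1" using approximatesD(2)[OF K_approximates] by blast
  next
    assume "\<exists>n. \<Phi> (diff_name p R) n = Some 1"
    then obtain n k where "K (diff_name p R) k n = Suc 1"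
      using approximatesD(2)[OF K_approximates] by blast
    \<comment> \<open>The stage is raised above the bit index \<open>n\<close>, as
      \<open>covered\<close> demands.\<close>
    then have "K (diff_name p R) (k + Suc n) n = Suc 1"
      by (rule approximatesD(3)[OF K_approximates]) simp
    then have "covered p R (k + Suc n)" by (auto simp: covered_def intro!: exI[of _ n])
    then show "\<exists>k. covered p R k" ..
  qed
  also have "\<dots> \<longleftrightarrow> (\<forall>\<xi> \<in> A. \<exists>e i. R e i \<and> \<xi> \<in> basic e)"
    using \<Phi>_empty_iff[OF closed_rep_diff_name[OF assms]] by blast
  finally show ?thesis .
qed

definition basic_union :: "nat \<Rightarrow> 'a set" where
  "basic_union l = (\<Union>e \<in> set_decode l. basic e)"

definition covers :: "cantor \<Rightarrow> nat \<Rightarrow> nat \<Rightarrow> bool" where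
  "covers p l k = covered p (\<lambda>e i. e \<in> set_decode l) k"

lemma covers_mono: "covers p l k \<Longrightarrow> k \<le> k' \<Longrightarrow> covers p l k'"
  unfolding covers_def by (rule covered_mono)

lemma ex_covers_iff:
  assumes "closed_rep \<delta> p = Some A"
  shows "(\<exists>k. covers p l k) \<longleftrightarrow> A \<subseteq> basic_union l"
  unfolding covers_def ex_covered_iff[OF assms] by (auto simp: basic_union_def)

text \<open>
  The empty test reads only finitely many bits of a name, so that it cannot distinguish an infinite
  union of basic sets from a finite part of it.
\<close>

lemma finite_subcover:
  assumes "closed_rep \<delta> p = Some A" "A \<subseteq> (\<Union>e \<in> E. basic e)"
  shows "\<exists>l. set_decode l \<subseteq> E \<and> A \<subseteq> basic_union l"
proof -
  let ?R = "\<lambda>e i :: nat. e \<in> E"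
  from assms(2) have "\<exists>k. covered p ?R k" unfolding ex_covered_iff[OF assms(1)] by blast
  then obtain k n where kn: "n < k" "K (diff_name p ?R) k n = Suc 1" by (auto simp: covered_def)
  let ?R' = "\<lambda>e i :: nat. e \<in> E \<and> e < k"
  \<comment> \<open>The index \<open>j\<close> bounds the output position, and the acceptance test
    at that position looks only at codes \<open>e\<close> below it; so restricting to
    \<open>e < k\<close> leaves the first \<open>k\<close> bits unchanged.\<close>
  have "diff_name p ?R j = diff_name p ?R' j" if "j < k" for j
  proof -
    have "pfst (psnd j) \<le> psnd j" "psnd j \<le> j"
      by (metis le_prod_encode_1 prod.collapse prod_decode_inverse,
          metis le_prod_encode_2 prod.collapse prod_decode_inverse)
    then have "pfst (psnd j) div 2 < k" using that by linarith
    then have "acc ?R x (pfst (psnd j) div 2) = acc ?R' x (pfst (psnd j) div 2)" for x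
      unfolding acc_def by (meson order_less_trans)
    then show ?thesis by (simp add: diff_name_def)
  qed
  then have "K (diff_name p ?R') k n = Suc 1"
    using kn(2) approximatesD(4)[OF K_approximates, of k "diff_name p ?R" "diff_name p ?R'" n] by simp
  then have "\<exists>k. covered p ?R' k" using kn(1) by (auto simp: covered_def)
  then have "A \<subseteq> (\<Union>e \<in> {e \<in> E. e < k}. basic e)" unfolding ex_covered_iff[OF assms(1)] by blast
  then show ?thesis
    by (intro exI[of _ "set_encode {e \<in> E. e < k}"]) (auto simp: basic_union_def)
qed

lemma decidable_covers [recursive_intros]:
  assumes [recursive_intros]: "total_recursive a" "total_recursive b"
  shows "decidable (\<lambda>p n. covers p (a p n) (b p n))"
proof -
  have K: "total_recursive (\<lambda>p m. K p (pfst m) (psnd m))"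
    by (intro approximatesD(1)[OF K_approximates] recursive_intros)
  have "total_recursive (\<lambda>p n. K (diff_name p (\<lambda>e i. e \<in> set_decode (a p (pfst n))))
      (pfst (prod_encode (b p (pfst n), psnd n))) (psnd (prod_encode (b p (pfst n), psnd n))))"
    by (rule total_recursive_substitute_oracle[OF K])
      (intro decidable_diff_name recursive_intros assms[THEN total_recursive_comp])+
  then have *: "total_recursive (\<lambda>p n. K (diff_name p (\<lambda>e i. e \<in> set_decode (a p (pfst n)))) (b p (pfst n)) (psnd n))"
    by simp
  show ?thesis
    unfolding covers_def covered_def
    by (intro recursive_intros *)
qed

text \<open>Substituting the fixed oracle \<open>full_name\<close> turns the test into one for
  covers of the whole space.\<close>

lemma decidable_covers_full_name [recursive_intros]:
  assumes "total_recursive a" "total_recursive b"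
  shows "decidable (\<lambda>p n. covers full_name (a p n) (b p n))"
proof -
  have 1: "decidable (\<lambda>p m. covers p (pfst m) (psnd m))" by (intro recursive_intros)
  have "decidable (\<lambda>p n. covers full_name (pfst (prod_encode (a p n, b p n)))
      (psnd (prod_encode (a p n, b p n))))"
    by (rule decidable_substitute_oracle[OF 1, where g = "\<lambda>p n. full_name"],
        unfold full_name_def) (intro recursive_intros assms)+
  then show ?thesis by simp
qed

end

section \<open>Counting branching nodes of a binary tree\<close>

text \<open>The nodes of the full binary tree are the positive integers; \<open>u\<close> has children \<open>2u\<close> and \<open>2u + 1\<close>.\<close>

lemma sum_children:
  fixes f :: "nat \<Rightarrow> nat"
  shows "sum f {2 * a..<2 * b} = (\<Sum>u = a..<b. f (2 * u) + f (2 * u + 1))"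
proof (induction b)
  case (Suc b)
  show ?case
  proof (cases "a \<le> b")
    case True
    have "{2 * a..<2 * Suc b} = insert (2 * b + 1) (insert (2 * b) {2 * a..<2 * b})"
      using True by auto
    with Suc True show ?thesis by simp
  qed simp
qed simp

text \<open>Each node has an excess \<open>h\<close>, its cardinality minus one. A node's excess is
  the sum of those of its children, plus one if it branches. Summed down to a level, the excess of
  the root is the number of branching nodes above plus the total excess on that level, which
  vanishes at level \<open>M\<close>.\<close>

lemma card_branching_nodes:
  fixes P :: "nat \<Rightarrow> 'b set"
  assumes fin: "finite (P 1)" and ne: "P 1 \<noteq> {}"
    and un: "\<And>u. u \<ge> 1 \<Longrightarrow> P u = P (2 * u) \<union> P (2 * u + 1)"
    and disj: "\<And>u. u \<ge> 1 \<Longrightarrow> P (2 * u) \<inter> P (2 * u + 1) = {}"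
    and M: "\<And>v. v \<ge> M \<Longrightarrow> card (P v) \<le> 1"
  defines "Br \<equiv> {u. u \<ge> 1 \<and> P (2 * u) \<noteq> {} \<and> P (2 * u + 1) \<noteq> {}}"
  shows "finite Br \<and> Suc (card Br) = card (P 1)"
proof -
  have finP: "finite (P v)" if "v \<ge> 1" for v
    using that
  proof (induction v rule: less_induct)
    case (less v)
    show ?case
    proof (cases "v = 1")
      case False
      then have "finite (P (v div 2))" using less by simp
      moreover have "P v \<subseteq> P (v div 2)"
      proof -
        have "v = 2 * (v div 2) \<or> v = 2 * (v div 2) + 1" by presburger
        moreover have "v div 2 \<ge> 1" using less(2) False by simp
        ultimately show ?thesis using un[of "v div 2"] by (metis Un_upper1 Un_upper2)
      qed
      ultimately show ?thesis by (rule finite_subset[rotated])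
    qed (use fin in simp)
  qed
  \<comment> \<open>Truncated subtraction gives the empty set the excess 0, so that a nonbranching
    node passes its excess on unchanged.\<close>
  define h where "h v = card (P v) - 1" for v
  have h: "h u = h (2 * u) + h (2 * u + 1) + of_bool (u \<in> Br)" if "u \<ge> 1" for u
  proof -
    have "card (P u) = card (P (2 * u)) + card (P (2 * u + 1))"
      using un[OF that] card_Un_disjoint[OF _ _ disj[OF that]] finP[of "2 * u"] finP[of "2 * u + 1"] that
      by simp
    moreover have "card (P v) = 0 \<longleftrightarrow> P v = {}" if "v \<ge> 1" for v
      using finP[OF that] by simp
    ultimately show ?thesis
      using that by (cases "card (P (2 * u))"; cases "card (P (2 * u + 1))") (auto simp: h_def Br_def)
  qed
  have level: "h 1 = card (Br \<inter> {..<2 ^ n}) + sum h {2 ^ n..<2 ^ Suc n}" for n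
  proof (induction n)
    case 0
    have "Br \<inter> {..<1} = {}" by (auto simp: Br_def)
    moreover have "{1..<2::nat} = {1}" by auto
    ultimately show ?case by simp
  next
    case (Suc n)
    have "sum h {2 ^ n..<2 ^ Suc n} =
        (\<Sum>u = 2 ^ n..<2 ^ Suc n. h (2 * u) + h (2 * u + 1) + of_bool (u \<in> Br))"
      by (intro sum.cong refl h) (metis atLeastLessThan_iff one_le_numeral one_le_power order_trans)
    also have "\<dots> = sum h {2 ^ Suc n..<2 ^ Suc (Suc n)} + card (Br \<inter> {2 ^ n..<2 ^ Suc n})"
      using sum_children[of h "2 ^ n" "2 ^ Suc n"]
      by (simp add: sum.distrib of_bool_def sum.If_cases Int_commute)
    finally have 1: "sum h {2 ^ n..<2 ^ Suc n} = \<dots>" .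
    have "Br \<inter> {..<2 ^ Suc n} = (Br \<inter> {..<2 ^ n}) \<union> (Br \<inter> {2 ^ n..<2 ^ Suc n})" by auto
    then have "card (Br \<inter> {..<2 ^ Suc n}) = card (Br \<inter> {..<2 ^ n}) + card (Br \<inter> {2 ^ n..<2 ^ Suc n})"
      by (simp add: card_Un_disjoint disjoint_iff)
    with 1 Suc show ?case by simp
  qed
  have h0: "h v = 0" if "v \<ge> M" for v using M[OF that] by (simp add: h_def)
  have "u < M" if "u \<in> Br" for u
  proof (rule ccontr)
    assume "\<not> u < M"
    with h0[of u] h[of u] that show False by (auto simp: Br_def)
  qed
  then have Br: "Br \<subseteq> {..<2 ^ M}" using less_exp order_less_trans by blast
  moreover have "sum h {2 ^ M..<2 ^ Suc M} = 0"
    by (intro sum.neutral ballI h0) (auto intro: order_trans[OF less_imp_le[OF less_exp]])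
  ultimately have "h 1 = card Br" using level[of M] by (simp add: Int_absorb2)
  moreover have "card (P 1) \<noteq> 0" using fin ne by simp
  ultimately show ?thesis using Br finite_subset by (auto simp: h_def)
qed

section \<open>Coding closed sets by sequences over Plotkin's domain\<close>

text \<open>The indices \<open>2 * k\<close> and \<open>2 * k + 1\<close> belong to the two opposite
  sets of the \<open>k\<close>-th pair.\<close>

definition flip :: "nat \<Rightarrow> nat" where
  "flip m = (if even m then m + 1 else m - 1)"

text \<open>The integer part of the binary logarithm: the depth of a node, with the root 1 at depth
  0.\<close>

definition level :: "nat \<Rightarrow> nat" where
  "level v = (LEAST n. v < 2 ^ Suc n)"

lemma total_recursive_flip [recursive_intros]:
  "total_recursive a \<Longrightarrow> total_recursive (\<lambda>p n. flip (a p n))"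
  unfolding flip_def by (intro recursive_intros)

lemma total_recursive_level [recursive_intros]:
  assumes "total_recursive a"
  shows "total_recursive (\<lambda>p n. level (a p n))"
  unfolding level_def
proof (rule total_recursive_Least)
  show "decidable (\<lambda>p m. a p (pfst m) < 2 ^ Suc (psnd m))"
    by (intro recursive_intros total_recursive_comp[OF assms])
  show "\<exists>k. a p n < 2 ^ Suc k" for p n
  proof (rule exI)
    have "a p n < 2 ^ a p n" by (rule less_exp)
    then show "a p n < 2 ^ Suc (a p n)" unfolding power_Suc by linarith
  qed
qed

lemma level_eq: "2 ^ n \<le> v \<Longrightarrow> v < 2 ^ Suc n \<Longrightarrow> level v = n"
  unfolding level_def
proof (rule Least_equality)
  fix m assume "2 ^ n \<le> v" "v < 2 ^ Suc m"
  then have "(2::nat) ^ n < 2 ^ Suc m" by linarith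
  then show "n \<le> m" using power_less_imp_less_exp[of "2::nat" n "Suc m"] by simp
qed

lemma set_decode_2_power [simp]: "set_decode (2 ^ m) = {m}"
  using set_encode_inverse[of "{m}"] by (simp add: set_encode_def)

text \<open>The ancestors of \<open>v\<close> are the numbers \<open>v div 2 ^ i\<close>, and the
  condition \<open>2 \<le>\<close> excludes the root. The bound \<open>i \<le> v\<close> gives
  decidability and loses nothing, as \<open>i < 2 ^ i\<close>. This recursion serves both
  \<open>removed\<close> and \<open>killed\<close>.\<close>

lemma ex_ancestor_iff:
  fixes v :: nat
  shows "(\<exists>i\<le>v. 2 \<le> v div 2 ^ i \<and> Q (v div 2 ^ i)) \<longleftrightarrow>
    2 \<le> v \<and> (Q v \<or> (\<exists>i\<le>v div 2. 2 \<le> v div 2 div 2 ^ i \<and> Q (v div 2 div 2 ^ i)))"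
  (is "?L \<longleftrightarrow> ?R")
proof
  assume ?L
  then obtain i where i: "i \<le> v" "2 \<le> v div 2 ^ i" "Q (v div 2 ^ i)" by blast
  then have v: "2 \<le> v" using div_le_dividend order_trans by blast
  show ?R
  proof (cases i)
    case 0
    with i v show ?thesis by simp
  next
    case (Suc j)
    then have eq: "v div 2 ^ i = v div 2 div 2 ^ j" by (simp add: div_mult2_eq)
    have "j < 2 ^ j" by (rule less_exp)
    also have "2 ^ j \<le> v div 2"
      using i(2) unfolding eq by (metis div_less leI not_numeral_le_zero)
    finally have "j \<le> v div 2" by simp
    with v i eq show ?thesis by auto
  qed
next
  assume R: ?R
  show ?L
  proof (cases "Q v")
    case True
    with R show ?thesis by (intro exI[of _ 0]) simp
  next
    case False
    with R obtain i where "i \<le> v div 2" "2 \<le> v div 2 div 2 ^ i" "Q (v div 2 div 2 ^ i)" by blast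
    then show ?thesis using R by (intro exI[of _ "Suc i"]) (auto simp: div_mult2_eq)
  qed
qed

lemma plotkin_seq_rep_eq:
  "plotkin_seq_rep p = Some (\<lambda>n. if \<exists>k. p (prod_encode (n, k))
     then Some (odd (LEAST k. p (prod_encode (n, k)))) else None)"
  unfolding seq_rep_def the_opt_eq_Some_iff plotkin_rep_def by auto

lemma computable_cantor_decidable:
  assumes "decidable g"
  shows "computable_cantor (\<lambda>p. Some (g p))"
  unfolding computable_cantor_def
proof (intro exI conjI allI)
  show "partial_recursive (\<lambda>p n. Some (of_bool (g p n)))"
    using assms by (simp add: decidable_def total_recursive_def)
  show "Some (g p) = the_opt (\<lambda>q. \<forall>n. Some (of_bool (g p n)) = Some (of_bool (q n) :: nat))" for p
    by (rule sym) (auto simp: the_opt_eq_Some_iff of_bool_eq_iff)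
qed

text \<open>
  In the notation of the paper, \<open>basic e\<close> is \<open>S(e)\<close>, and \<open>separated e f\<close> says that \<open>bar S(e)\<close> and \<open>bar S(f)\<close> are
  disjoint, a condition that is semidecidable by compactness.
\<close>

definition (in effectively_compact_subbase) separated :: "nat \<Rightarrow> nat \<Rightarrow> bool" where
  "separated e f \<longleftrightarrow> (\<forall>\<xi> \<in> ran \<delta>. \<exists>m \<in> set_decode e \<union> set_decode f. \<xi> \<in> B (flip m))"

text \<open>The separation properties needed for the coding. A point in \<open>B (flip m)\<close>
  with \<open>m\<close> in the index set of \<open>e\<close> lies outside \<open>bar S(e)\<close>,
  so the second assumption is regularity in terms of finite data.\<close>

locale separating_subbase = effectively_compact_subbase \<delta> B ver K \<Phi>
  for \<delta> :: "'a rep" and B ver K \<Phi> +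
  assumes B_disjoint: "B m \<inter> B (flip m) = {}"
    and ex_separated_basic:
      "\<xi> \<in> ran \<delta> \<Longrightarrow> m \<in> set_decode e \<Longrightarrow> \<xi> \<in> B (flip m) \<Longrightarrow> \<exists>f. \<xi> \<in> basic f \<and> separated f e"
    and ex_separated_points:
      "\<xi> \<in> ran \<delta> \<Longrightarrow> \<eta> \<in> ran \<delta> \<Longrightarrow> \<xi> \<noteq> \<eta> \<Longrightarrow> \<exists>e f. \<xi> \<in> basic e \<and> \<eta> \<in> basic f \<and> separated e f"
begin

section \<open>Valid pairs and their extension\<close>

lemma separated_commute: "separated e f \<Longrightarrow> separated f e"
  unfolding separated_def by (simp add: Un_commute)

lemma separated_mono: "separated e f \<Longrightarrow> set_decode e \<subseteq> set_decode e' \<Longrightarrow> separated e' f"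
  unfolding separated_def by blast

lemma separated_disjoint: "separated e f \<Longrightarrow> basic e \<inter> basic f = {}"
  unfolding separated_def basic_def using B_disjoint by blast

definition valid :: "nat \<Rightarrow> nat \<Rightarrow> bool" where
  "valid c d \<longleftrightarrow> (\<forall>e \<in> set_decode c. \<forall>f \<in> set_decode d. separated e f)"

text \<open>The stagewise form of \<open>separated\<close>: a finite cover of the space by sets
  \<open>B (flip m)\<close>, where \<open>2 ^ flip m\<close> codes a singleton index set. The bounds
  on \<open>l\<close> and \<open>m\<close> make the search decidable.\<close>

definition separated_at :: "nat \<Rightarrow> nat \<Rightarrow> nat \<Rightarrow> bool" where
  "separated_at e f k \<longleftrightarrow> (\<exists>l\<le>k. covers full_name l k \<and>
     (\<forall>g \<in> set_decode l. \<exists>m<e + f. (m \<in> set_decode e \<or> m \<in> set_decode f) \<and> g = 2 ^ flip m))"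

definition valid_at :: "nat \<Rightarrow> nat \<Rightarrow> nat \<Rightarrow> bool" where
  "valid_at c d k \<longleftrightarrow> (\<forall>e \<in> set_decode c. \<forall>f \<in> set_decode d. separated_at e f k)"

lemma decidable_valid_at [recursive_intros]:
  assumes "total_recursive a" "total_recursive b" "total_recursive c"
  shows "decidable (\<lambda>p n. valid_at (a p n) (b p n) (c p n))"
proof -
  have "decidable (\<lambda>p m. valid_at (pfst m) (pfst (psnd m)) (psnd (psnd m)))"
    unfolding valid_at_def separated_at_def by (intro recursive_intros)
  from decidable_comp3[OF this assms] show ?thesis .
qed

lemma separated_at_imp: "separated_at e f k \<Longrightarrow> separated e f"
proof -
  assume "separated_at e f k"
  then obtain l where l: "covers full_name l k"
    "\<forall>g \<in> set_decode l. \<exists>m<e + f. (m \<in> set_decode e \<or> m \<in> set_decode f) \<and> g = 2 ^ flip m"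
    unfolding separated_at_def by blast
  then have "ran \<delta> \<subseteq> basic_union l" using ex_covers_iff[OF closed_rep_full_name] by blast
  with l(2) show ?thesis unfolding separated_def basic_union_def basic_def by fastforce
qed

lemma eventually_separated_at:
  assumes "separated e f"
  shows "\<forall>\<^sub>F k in sequentially. separated_at e f k"
proof -
  define l where "l = set_encode ((\<lambda>m. 2 ^ flip m) ` (set_decode e \<union> set_decode f))"
  have l: "set_decode l = (\<lambda>m. 2 ^ flip m) ` (set_decode e \<union> set_decode f)"
    by (simp add: l_def)
  have "ran \<delta> \<subseteq> basic_union l"
    using assms unfolding separated_def basic_union_def basic_def l by auto
  then obtain k where k: "covers full_name l k" using ex_covers_iff[OF closed_rep_full_name] by blast
  have "separated_at e f k'" if "k' \<ge> k + l" for k'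
  proof -
    have "covers full_name l k'" using covers_mono[OF k] that by simp
    moreover have "m < e + f" if "m \<in> set_decode e \<or> m \<in> set_decode f" for m
      using that less_of_mem_set_decode by fastforce
    ultimately show ?thesis unfolding separated_at_def using that l
      by (intro exI[of _ l]) auto
  qed
  then show ?thesis by (auto simp: eventually_sequentially)
qed

lemma valid_at_imp: "valid_at c d k \<Longrightarrow> valid c d"
  unfolding valid_at_def valid_def using separated_at_imp by blast

lemma eventually_valid_at:
  assumes "valid c d"
  shows "\<forall>\<^sub>F k in sequentially. valid_at c d k"
  using assms unfolding valid_at_def valid_def
  by (intro eventually_ball_finite finite_set_decode ballI eventually_separated_at) blast

text \<open>Points are added one by one. By validity a point cannot lie both in some
  \<open>bar S(e)\<close> with \<open>e\<close> from \<open>c'\<close> and in some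
  \<open>bar S(f)\<close> with \<open>f\<close> from \<open>d'\<close>. If it avoids all of one
  side, a neighbourhood separated from that side joins the other.\<close>

lemma valid_extend:
  assumes "finite F" "F \<subseteq> ran \<delta>" "valid c d"
  shows "\<exists>c' d'. set_decode c \<subseteq> set_decode c' \<and> set_decode d \<subseteq> set_decode d' \<and> valid c' d' \<and>
    F \<subseteq> basic_union c' \<union> basic_union d'"
  using assms(1,2)
proof (induction F)
  case empty
  then show ?case using assms(3) by blast
next
  case (insert \<xi> F)
  then obtain c' d' where IH: "set_decode c \<subseteq> set_decode c'" "set_decode d \<subseteq> set_decode d'"
    "valid c' d'" "F \<subseteq> basic_union c' \<union> basic_union d'" by auto
  have near: "\<exists>f. \<xi> \<in> basic f \<and> (\<forall>e \<in> set_decode a. separated f e)"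
    if "\<forall>e \<in> set_decode a. \<exists>m \<in> set_decode e. \<xi> \<in> B (flip m)" for a
  proof -
    have "\<forall>e \<in> set_decode a. \<exists>f. \<xi> \<in> basic f \<and> separated f e"
      using that ex_separated_basic insert.prems by blast
    then obtain F where F: "\<And>e. e \<in> set_decode a \<Longrightarrow> \<xi> \<in> basic (F e) \<and> separated (F e) e" by metis
    \<comment> \<open>The union of the index sets codes the intersection of the neighbourhoods,
      which is separated from every member of the side at once.\<close>
    define f where "f = set_encode (\<Union>e \<in> set_decode a. set_decode (F e))"
    have f: "set_decode f = (\<Union>e \<in> set_decode a. set_decode (F e))" by (simp add: f_def)
    have "\<xi> \<in> basic f" using F insert.prems unfolding basic_def f by auto
    moreover have "separated f e" if "e \<in> set_decode a" for e
      using separated_mono[of "F e" e f] F[OF that] that f by blast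
    ultimately show ?thesis by blast
  qed
  have add: "set_decode (set_encode (insert f (set_decode a))) = insert f (set_decode a)" for f a
    by (rule set_encode_inverse) simp
  consider "\<forall>e \<in> set_decode c'. \<exists>m \<in> set_decode e. \<xi> \<in> B (flip m)"
    | "\<forall>e \<in> set_decode d'. \<exists>m \<in> set_decode e. \<xi> \<in> B (flip m)"
    using IH(3) insert.prems unfolding valid_def separated_def by (metis UnE insert_subset)
  then show ?case
  proof cases
    case 1
    then obtain f where f: "\<xi> \<in> basic f" "\<forall>e \<in> set_decode c'. separated f e" using near by blast
    show ?thesis
      using IH f separated_commute
      by (intro exI[of _ c'] exI[of _ "set_encode (insert f (set_decode d'))"])
        (auto simp: valid_def add basic_union_def)
  next
    case 2
    then obtain f where f: "\<xi> \<in> basic f" "\<forall>e \<in> set_decode d'. separated f e" using near by blast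
    show ?thesis
      using IH f
      by (intro exI[of _ d'] exI[of _ "set_encode (insert f (set_decode c'))"])
        (auto simp: valid_def add basic_union_def)
  qed
qed

text \<open>
  The task of level \<open>n\<close> is the pair \<open>(c, d)\<close> coded in \<open>n\<close>, provided that it is seen to be valid within the
  number of stages coded in \<open>n\<close>. Descending to the left child removes the sets of \<open>d\<close>, descending to
  the right child those of \<open>c\<close>.
\<close>

definition task :: "bool \<Rightarrow> nat \<Rightarrow> nat" where
  "task b n = (if valid_at (pfst n) (pfst (psnd n)) (psnd (psnd n))
     then if b then pfst n else pfst (psnd n) else 0)"

text \<open>An item \<open>\<langle>u, c, d, l, k\<rangle>\<close> proposes \<open>(c, d)\<close> as a refinement of the task at the node \<open>u\<close>.\<close>

definition item_node :: "nat \<Rightarrow> nat" where "item_node s = pfst s"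
definition item :: "bool \<Rightarrow> nat \<Rightarrow> nat" where
  "item b s = (if b then pfst (psnd s) else pfst (psnd (psnd s)))"
definition item_cover :: "nat \<Rightarrow> nat" where "item_cover s = pfst (psnd (psnd (psnd s)))"
definition item_stage :: "nat \<Rightarrow> nat" where "item_stage s = psnd (psnd (psnd (psnd s)))"

text \<open>This concerns the edge from \<open>w div 2\<close> to \<open>w\<close>; an odd
  \<open>w\<close> is a right child. An item adds to the task instead of replacing it, which agrees
  with replacement since an accepted item contains the task.\<close>

definition removed_at :: "nat set \<Rightarrow> nat \<Rightarrow> nat \<Rightarrow> bool" where
  "removed_at M w e \<longleftrightarrow> e \<in> set_decode (task (odd w) (level (w div 2))) \<or>
     (\<exists>s \<in> M. item_node s = w div 2 \<and> e \<in> set_decode (item (odd w) s))"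

definition removed :: "nat set \<Rightarrow> nat \<Rightarrow> nat \<Rightarrow> bool" where
  "removed M v e \<longleftrightarrow> (\<exists>i\<le>v. 2 \<le> v div 2 ^ i \<and> removed_at M (v div 2 ^ i) e)"

lemma removed_iff: "removed M v e \<longleftrightarrow> 2 \<le> v \<and> (removed_at M v e \<or> removed M (v div 2) e)"
  unfolding removed_def using ex_ancestor_iff[of v "\<lambda>w. removed_at M w e"] by simp

lemma removed_mono: "removed M v e \<Longrightarrow> M \<subseteq> M' \<Longrightarrow> removed M' v e"
  unfolding removed_def removed_at_def by blast

lemma valid_task: "valid (task True n) (task False n)"
  using valid_at_imp by (auto simp: task_def valid_def)

text \<open>At most one refinement is allowed per node. The last two conditions certify that the
  part at the node lies in the union of the pair: the cover of the whole closed set uses only sets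
  of the pair and sets already removed on the way to the node.\<close>

definition acceptable :: "cantor \<Rightarrow> nat \<Rightarrow> nat \<Rightarrow> bool" where
  "acceptable p \<sigma> s \<longleftrightarrow> 1 \<le> item_node s \<and> (\<forall>s' \<in> set_decode \<sigma>. item_node s' \<noteq> item_node s) \<and>
     valid_at (item True s) (item False s) (item_stage s) \<and>
     (\<forall>e \<in> set_decode (task True (level (item_node s))). e \<in> set_decode (item True s)) \<and>
     (\<forall>e \<in> set_decode (task False (level (item_node s))). e \<in> set_decode (item False s)) \<and>
     covers p (item_cover s) (item_stage s) \<and>
     (\<forall>e \<in> set_decode (item_cover s). e \<in> set_decode (item True s) \<or>
        e \<in> set_decode (item False s) \<or> removed (set_decode \<sigma>) (item_node s) e)"

text \<open>Candidates are tested in order of their codes, each against the set of those accepted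
  before it; the state is the code of that set.\<close>

definition state :: "cantor \<Rightarrow> nat \<Rightarrow> nat" where
  "state p k = rec_nat 0 (\<lambda>s \<sigma>. \<sigma> + of_bool (acceptable p \<sigma> s) * 2 ^ s) k"

definition accepted :: "cantor \<Rightarrow> nat set" where
  "accepted p = {s. acceptable p (state p s) s}"

text \<open>
  Position \<open>0\<close> reports that the closed set is empty. At a position \<open>v \<ge> 1\<close>, the bit with index
  \<open>2\<langle>l, k\<rangle> + b\<close> reports that \<open>l\<close> witnesses the emptiness of the part at the child \<open>2v + b\<close>, so that the
  parity of the first report tells which child is abandoned.
\<close>

definition out :: "cantor \<Rightarrow> cantor" where
  "out p m \<longleftrightarrow> (if pfst m = 0 then covers p 0 (psnd m)
     else covers p (pfst (psnd m div 2)) (psnd (psnd m div 2)) \<and>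
       (\<forall>e \<in> set_decode (pfst (psnd m div 2)).
          removed (set_decode (state p (psnd (psnd m div 2))))
            (2 * pfst m + of_bool (odd (psnd m))) e))"

text \<open>The sequence denoted by the name \<open>out p\<close>. It depends on the name
  \<open>p\<close> and not only on the closed set.\<close>

definition code :: "cantor \<Rightarrow> nat \<Rightarrow> bool option" where
  "code p v = (if \<exists>k. out p (prod_encode (v, k)) then Some (odd (LEAST k. out p (prod_encode (v, k))))
     else None)"

section \<open>Effectivity of the coding and the limit of its states\<close>

lemma total_recursive_task [recursive_intros]:
  "decidable P \<Longrightarrow> total_recursive a \<Longrightarrow> total_recursive (\<lambda>p n. task (P p n) (a p n))"
  unfolding task_def by (intro recursive_intros)

lemma total_recursive_item [recursive_intros]:
  "total_recursive a \<Longrightarrow> total_recursive (\<lambda>p n. item_node (a p n))"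
  "decidable P \<Longrightarrow> total_recursive a \<Longrightarrow> total_recursive (\<lambda>p n. item (P p n) (a p n))"
  "total_recursive a \<Longrightarrow> total_recursive (\<lambda>p n. item_cover (a p n))"
  "total_recursive a \<Longrightarrow> total_recursive (\<lambda>p n. item_stage (a p n))"
  unfolding item_node_def item_def item_cover_def item_stage_def by (intro recursive_intros; assumption)+

lemma decidable_removed [recursive_intros]:
  assumes "total_recursive a" "total_recursive b" "total_recursive c"
  shows "decidable (\<lambda>p n. removed (set_decode (a p n)) (b p n) (c p n))"
proof -
  have "decidable (\<lambda>p m. removed (set_decode (pfst m)) (pfst (psnd m)) (psnd (psnd m)))"
    unfolding removed_def removed_at_def by (intro recursive_intros)
  from decidable_comp3[OF this assms] show ?thesis .
qed

lemma total_recursive_state [recursive_intros]: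
  "total_recursive a \<Longrightarrow> total_recursive (\<lambda>p n. state p (a p n))"
  unfolding state_def acceptable_def by (intro recursive_intros)

lemma decidable_out: "decidable out"
  unfolding out_def by (intro recursive_intros)

lemma set_decode_state: "set_decode (state p k) = accepted p \<inter> {..<k}"
proof (induction k)
  case 0
  show ?case by (simp add: state_def)
next
  case (Suc k)
  have state: "state p (Suc k) = (if k \<in> accepted p then 2 ^ k + state p k else state p k)"
    by (simp add: state_def accepted_def)
  have "k \<notin> set_decode (state p k)" using Suc by simp
  then have "set_decode (2 ^ k + state p k) = insert k (set_decode (state p k))"
    by (rule set_decode_plus_power_2)
  with state have "set_decode (state p (Suc k)) =
      (if k \<in> accepted p then insert k (set_decode (state p k)) else set_decode (state p k))" by simp
  then show ?case unfolding Suc lessThan_Suc by (simp add: Int_insert_right)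
qed

text \<open>The later of two items at one node would have met the earlier one in its state.\<close>

lemma accepted_unique:
  assumes "s \<in> accepted p" "s' \<in> accepted p" "item_node s = item_node s'"
  shows "s = s'"
proof -
  have "\<not> s < s'" if "s \<in> accepted p" "s' \<in> accepted p" "item_node s = item_node s'" for s s'
  proof
    assume "s < s'"
    with that(1) have "s \<in> set_decode (state p s')" by (simp add: set_decode_state)
    with that(2,3) show False unfolding accepted_def acceptable_def by auto
  qed
  then show ?thesis using assms by (metis nat_neq_iff)
qed

lemma accepted_valid: "s \<in> accepted p \<Longrightarrow> valid (item True s) (item False s)"
  unfolding accepted_def acceptable_def using valid_at_imp by blast

lemma task_subset_item:
  "s \<in> accepted p \<Longrightarrow> item_node s = u \<Longrightarrow> set_decode (task b (level u)) \<subseteq> set_decode (item b s)"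
  unfolding accepted_def acceptable_def by (cases b) auto

text \<open>A removal is due to a task or to a single accepted item, hence is visible from some
  state on.\<close>

lemma eventually_removed_state:
  assumes "removed (accepted p) v e"
  shows "\<forall>\<^sub>F k in sequentially. removed (set_decode (state p k)) v e"
proof -
  from assms obtain i where i: "i \<le> v" "2 \<le> v div 2 ^ i" "removed_at (accepted p) (v div 2 ^ i) e"
    unfolding removed_def by blast
  then obtain k where "removed_at (accepted p \<inter> {..<k}) (v div 2 ^ i) e"
    unfolding removed_at_def by blast
  then have "removed (set_decode (state p k)) v e"
    using i unfolding removed_def set_decode_state by blast
  then have "removed (set_decode (state p k')) v e" if "k' \<ge> k" for k'
    by (rule removed_mono) (use that in \<open>auto simp: set_decode_state\<close>)
  then show ?thesis by (auto simp: eventually_sequentially)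
qed

section \<open>The parts of a closed set at the nodes of the tree\<close>

definition part :: "cantor \<Rightarrow> 'a set \<Rightarrow> nat \<Rightarrow> 'a set" where
  "part p A v = {\<xi> \<in> A. \<forall>e. removed (accepted p) v e \<longrightarrow> \<xi> \<notin> basic e}"

context
  fixes p A
  assumes p: "closed_rep \<delta> p = Some A"
begin

lemma A_subset: "A \<subseteq> ran \<delta>"
  using p by (simp add: closed_rep_eq_Some_iff)

lemma part_1: "part p A 1 = A"
  unfolding part_def by (subst removed_iff) simp

lemma part_child:
  assumes "u \<ge> 1"
  shows "part p A (2 * u + of_bool b) =
    {\<xi> \<in> part p A u. \<forall>e. removed_at (accepted p) (2 * u + of_bool b) e \<longrightarrow> \<xi> \<notin> basic e}"
proof -
  have "removed (accepted p) (2 * u + of_bool b) e \<longleftrightarrow>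
      removed_at (accepted p) (2 * u + of_bool b) e \<or> removed (accepted p) u e" for e
    using assms by (subst removed_iff) simp
  then show ?thesis by (auto simp: part_def)
qed

lemma removed_at_child:
  "removed_at M (2 * u + of_bool b) e \<longleftrightarrow> e \<in> set_decode (task b (level u)) \<or>
     (\<exists>s \<in> M. item_node s = u \<and> e \<in> set_decode (item b s))"
  by (simp add: removed_at_def)

text \<open>No point is removed on both sides: all sets removed at \<open>u\<close> come from one
  valid pair, namely the accepted item if there is one, which contains the task, and the task
  otherwise.\<close>

lemma part_union:
  assumes "u \<ge> 1"
  shows "part p A u = part p A (2 * u) \<union> part p A (2 * u + 1)"
proof -
  have "basic e \<inter> basic f = {}"
    if e: "removed_at (accepted p) (2 * u + of_bool True) e"
      and f: "removed_at (accepted p) (2 * u + of_bool False) f" for e f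
  proof -
    have "separated e f"
    proof (cases "\<exists>s \<in> accepted p. item_node s = u")
      case True
      then obtain s where s: "s \<in> accepted p" "item_node s = u" by blast
      have "g \<in> set_decode (item b s)" if "removed_at (accepted p) (2 * u + of_bool b) g" for b g
        using that unfolding removed_at_child
      proof (elim disjE bexE conjE)
        assume "g \<in> set_decode (task b (level u))"
        then show ?thesis using task_subset_item[OF s] by blast
      next
        fix s' assume "s' \<in> accepted p" "item_node s' = u" "g \<in> set_decode (item b s')"
        then show ?thesis using accepted_unique[OF s(1), of s'] s(2) by simp
      qed
      from this[OF e] this[OF f] show ?thesis using accepted_valid[OF s(1)] by (auto simp: valid_def)
    next
      case False
      then show ?thesis using e f valid_task[of "level u"] unfolding removed_at_child valid_def by blast
    qed
    then show ?thesis by (rule separated_disjoint)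
  qed
  then show ?thesis
    using part_child[OF assms, of True] part_child[OF assms, of False] by auto
qed

lemma part_mono:
  assumes "v \<ge> 2"
  shows "part p A v \<subseteq> part p A (v div 2)"
proof -
  have "v div 2 \<ge> 1" "2 * (v div 2) + of_bool (odd v) = v" using assms by simp_all
  then show ?thesis using part_child[of "v div 2" "odd v"] by auto
qed

text \<open>Compactness leaves finitely many sets, and the removals among them are all visible in
  late states. So a fixed finite cover is certified at all late stages; \<open>E\<close> holds sets
  of a proposed pair.\<close>

lemma ex_covers_removed:
  assumes "A \<subseteq> (\<Union>e \<in> E \<union> {e. removed (accepted p) v e}. basic e)"
  shows "\<exists>l. \<forall>\<^sub>F k in sequentially. covers p l k \<and>
    (\<forall>e \<in> set_decode l. e \<in> E \<or> removed (set_decode (state p k)) v e)"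
proof -
  from finite_subcover[OF p assms] obtain l where
    l: "set_decode l \<subseteq> E \<union> {e. removed (accepted p) v e}" "A \<subseteq> basic_union l" by blast
  from l(2) obtain k where "covers p l k" using ex_covers_iff[OF p] by blast
  then have "\<forall>\<^sub>F k in sequentially. covers p l k"
    unfolding eventually_sequentially using covers_mono by blast
  moreover have "\<forall>\<^sub>F k in sequentially. \<forall>e \<in> set_decode l. e \<in> E \<or> removed (set_decode (state p k)) v e"
  proof (intro eventually_ball_finite finite_set_decode ballI)
    fix e assume "e \<in> set_decode l"
    with l(1) consider "e \<in> E" | "removed (accepted p) v e" by blast
    then show "\<forall>\<^sub>F k in sequentially. e \<in> E \<or> removed (set_decode (state p k)) v e"
    proof cases
      case 2
      then show ?thesis by (rule eventually_mono[OF eventually_removed_state]) simp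
    qed simp
  qed
  ultimately show ?thesis by (auto intro: eventually_conj)
qed

text \<open>If nothing were accepted at \<open>u\<close>, a valid extension of the task covering
  \<open>A\<close> would meet every condition at some stage \<open>k\<close>, and the item made from
  it would be accepted.\<close>

lemma ex_accepted:
  assumes "finite A" "u \<ge> 1"
  shows "\<exists>s \<in> accepted p. item_node s = u"
proof (rule ccontr)
  assume none: "\<not> ?thesis"
  obtain c d where cd: "set_decode (task True (level u)) \<subseteq> set_decode c"
    "set_decode (task False (level u)) \<subseteq> set_decode d" "valid c d" "A \<subseteq> basic_union c \<union> basic_union d"
    using valid_extend[OF assms(1) A_subset valid_task] by blast
  let ?E = "set_decode c \<union> set_decode d"
  have "A \<subseteq> (\<Union>e \<in> ?E \<union> {e. removed (accepted p) u e}. basic e)"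
    using cd(4) by (auto simp: basic_union_def)
  from ex_covers_removed[OF this] obtain l where
    l: "\<forall>\<^sub>F k in sequentially. covers p l k \<and> (\<forall>e \<in> set_decode l. e \<in> ?E \<or> removed (set_decode (state p k)) u e)"
    by blast
  from eventually_conj[OF l eventually_valid_at[OF cd(3)]] obtain k where
    k: "covers p l k" "\<forall>e \<in> set_decode l. e \<in> ?E \<or> removed (set_decode (state p k)) u e" "valid_at c d k"
    by (auto simp: eventually_sequentially)
  define s where "s = prod_encode (u, prod_encode (c, prod_encode (d, prod_encode (l, k))))"
  have s: "item_node s = u" "item True s = c" "item False s = d" "item_cover s = l" "item_stage s = k"
    by (simp_all add: s_def item_node_def item_def item_cover_def item_stage_def)
  \<comment> \<open>An item is tested at the time given by its own code, which is at least its
    stage; the removals known at stage \<open>k\<close> are known by then.\<close>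
  have "k \<le> s" unfolding s_def using le_prod_encode_2 order_trans by meson
  then have "set_decode (state p k) \<subseteq> set_decode (state p s)" by (auto simp: set_decode_state)
  then have "\<forall>e \<in> set_decode l. e \<in> ?E \<or> removed (set_decode (state p s)) u e"
    using k(2) removed_mono by blast
  moreover have "\<forall>s' \<in> set_decode (state p s). item_node s' \<noteq> u"
    using none by (auto simp: set_decode_state)
  ultimately have "s \<in> accepted p"
    using assms(2) cd k unfolding accepted_def acceptable_def by (auto simp: s)
  with none s(1) show False by blast
qed

text \<open>A point of both parts lies in a set of the accepted cover. This set is removed on the
  right if it is in \<open>c\<close>, on the left if it is in \<open>d\<close>, and otherwise was
  removed above.\<close>

lemma part_disjoint:
  assumes "finite A" "u \<ge> 1"
  shows "part p A (2 * u) \<inter> part p A (2 * u + 1) = {}"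
proof -
  obtain s where s: "s \<in> accepted p" "item_node s = u" using ex_accepted[OF assms] by blast
  then have acc: "acceptable p (state p s) s" by (simp add: accepted_def)
  then have cov: "A \<subseteq> basic_union (item_cover s)"
    using ex_covers_iff[OF p] unfolding acceptable_def by blast
  have "False" if \<xi>: "\<xi> \<in> part p A (2 * u)" "\<xi> \<in> part p A (2 * u + 1)" for \<xi>
  proof -
    have "\<xi> \<in> A" using \<xi> by (simp add: part_def)
    with cov obtain e where e: "e \<in> set_decode (item_cover s)" "\<xi> \<in> basic e"
      by (auto simp: basic_union_def)
    from acc e(1) consider "e \<in> set_decode (item True s)" | "e \<in> set_decode (item False s)"
      | "removed (accepted p) u e"
      using s(2) removed_mono[of "set_decode (state p s)" u e "accepted p"]
      unfolding acceptable_def set_decode_state by blast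
    then show False
    proof cases
      case 1
      then have "removed_at (accepted p) (2 * u + of_bool True) e"
        unfolding removed_at_child using s by blast
      with \<xi>(2) e(2) part_child[OF assms(2), of True] show False by auto
    next
      case 2
      then have "removed_at (accepted p) (2 * u + of_bool False) e"
        unfolding removed_at_child using s by blast
      with \<xi>(1) e(2) part_child[OF assms(2), of False] show False by auto
    next
      case 3
      have "\<xi> \<in> part p A u" using \<xi>(1) part_union[OF assms(2)] by blast
      with 3 e(2) show False by (simp add: part_def)
    qed
  qed
  then show ?thesis by blast
qed

lemma out_imp_part_empty:
  assumes "v \<ge> 1" "out p (prod_encode (v, j))"
  shows "part p A (2 * v + of_bool (odd j)) = {}"
proof -
  define l k where "l = pfst (j div 2)" "k = psnd (j div 2)"
  from assms have l: "covers p l k" 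
    "\<forall>e \<in> set_decode l. removed (set_decode (state p k)) (2 * v + of_bool (odd j)) e"
    unfolding out_def l_k_def by simp_all
  then have "A \<subseteq> basic_union l" using ex_covers_iff[OF p] by blast
  moreover have "\<forall>e \<in> set_decode l. removed (accepted p) (2 * v + of_bool (odd j)) e"
    using l(2) removed_mono[of "set_decode (state p k)" _ _ "accepted p"] unfolding set_decode_state by blast
  ultimately show ?thesis unfolding part_def basic_union_def by blast
qed

text \<open>Emptiness of a child's part is certified by a finite cover of removed sets; the cover,
  the stage and the child together give the position of the report.\<close>

lemma ex_out:
  assumes "v \<ge> 1" "part p A (2 * v + of_bool b) = {}"
  shows "\<exists>j. out p (prod_encode (v, j))"
proof -
  have "A \<subseteq> (\<Union>e \<in> {} \<union> {e. removed (accepted p) (2 * v + of_bool b) e}. basic e)"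
    using assms(2) by (auto simp: part_def)
  from ex_covers_removed[OF this] obtain l k where
    "covers p l k" "\<forall>e \<in> set_decode l. removed (set_decode (state p k)) (2 * v + of_bool b) e"
    by (auto simp: eventually_sequentially)
  then have "out p (prod_encode (v, 2 * prod_encode (l, k) + of_bool b))"
    using assms(1) unfolding out_def by simp
  then show ?thesis ..
qed

text \<open>The number 0 codes the empty family, so the test at position 0 asks whether nothing is
  needed to cover \<open>A\<close>.\<close>

lemma code_0: "code p 0 = None \<longleftrightarrow> A \<noteq> {}"
proof -
  have "(\<exists>k. out p (prod_encode (0, k))) \<longleftrightarrow> A \<subseteq> basic_union 0"
    unfolding out_def ex_covers_iff[OF p, symmetric] by simp
  then show ?thesis by (simp add: code_def basic_union_def)
qed

lemma code_Some: "v \<ge> 1 \<Longrightarrow> code p v = Some b \<Longrightarrow> part p A (2 * v + of_bool b) = {}"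
proof -
  assume v: "v \<ge> 1" "code p v = Some b"
  then have ex: "\<exists>j. out p (prod_encode (v, j))" by (auto simp: code_def split: if_splits)
  from out_imp_part_empty[OF v(1) LeastI_ex[OF ex]] v(2) ex show ?thesis by (simp add: code_def)
qed

lemma code_None: "v \<ge> 1 \<Longrightarrow> code p v = None \<Longrightarrow> part p A (2 * v + of_bool b) \<noteq> {}"
  using ex_out[of v b] by (auto simp: code_def split: if_splits)

end

section \<open>Recovering the closed set from its code\<close>

definition killed :: "(nat \<Rightarrow> bool option) \<Rightarrow> nat \<Rightarrow> bool" where
  "killed q v \<longleftrightarrow> q 0 \<noteq> None \<or> (\<exists>i\<le>v. 2 \<le> v div 2 ^ i \<and> q (v div 2 ^ i div 2) = Some (odd (v div 2 ^ i)))"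

text \<open>An entry \<open>Some b\<close> abandons the child of parity \<open>b\<close> with all
  its descendants; a proper entry at position 0 abandons every node.\<close>

lemma killed_iff:
  "killed q v \<longleftrightarrow> q 0 \<noteq> None \<or> 2 \<le> v \<and> (q (v div 2) = Some (odd v) \<or> killed q (v div 2))"
  unfolding killed_def using ex_ancestor_iff[of v "\<lambda>w. q (w div 2) = Some (odd w)"] by blast

text \<open>Only tasks count as removals here, since the accepted items depend on a name of the
  closed set, which the sequence does not provide.\<close>

definition decode :: "(nat \<Rightarrow> bool option) \<Rightarrow> 'a set" where
  "decode q = {\<xi> \<in> ran \<delta>. \<forall>n. \<exists>v. 2 ^ n \<le> v \<and> v < 2 ^ Suc n \<and> \<not> killed q v \<and>
     (\<forall>e. removed {} v e \<longrightarrow> \<xi> \<notin> basic e)}"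

text \<open>If the part at \<open>v\<close> is empty but that of its parent is not, then the
  sibling's part is nonempty. The emptiness at \<open>v\<close> is reported eventually, and no
  report for the sibling can come first.\<close>

lemma killed_code_iff:
  assumes p: "closed_rep \<delta> p = Some A" and "A \<noteq> {}" "v \<ge> 1"
  shows "killed (code p) v \<longleftrightarrow> part p A v = {}"
  using assms(3)
proof (induction v rule: less_induct)
  case (less v)
  have code0: "code p 0 = None" using code_0[OF p] assms(2) by blast
  show ?case
  proof (cases "v = 1")
    case True
    then show ?thesis using part_1[OF p] assms(2) code0 by (subst killed_iff) simp
  next
    case False
    define u where "u = v div 2"
    have u: "u \<ge> 1" "u < v" "v = 2 * u + of_bool (odd v)" using less(2) False by (auto simp: u_def)
    have IH: "killed (code p) u \<longleftrightarrow> part p A u = {}" using less(1)[OF u(2,1)] .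
    have un: "part p A u = part p A (2 * u + of_bool (odd v)) \<union> part p A (2 * u + of_bool (even v))"
      using part_union[OF p u(1)] by (cases "odd v") auto
    have kv: "killed (code p) v \<longleftrightarrow> code p u = Some (odd v) \<or> killed (code p) u"
      using code0 less(2) False by (subst killed_iff) (auto simp: u_def)
    show ?thesis
    proof
      assume "killed (code p) v"
      then show "part p A v = {}"
        using kv IH un u(3) code_Some[OF p u(1)] by (metis Un_empty)
    next
      assume empty: "part p A v = {}"
      show "killed (code p) v"
      proof (rule ccontr)
        assume "\<not> killed (code p) v"
        then have nk: "code p u \<noteq> Some (odd v)" "part p A u \<noteq> {}" using kv IH by auto
        then have "part p A (2 * u + of_bool (even v)) \<noteq> {}" using un empty u(3) by auto
        then have "code p u \<noteq> Some (even v)" using code_Some[OF p u(1), of "even v"] by auto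
        with nk(1) have "code p u = None" by (cases "code p u") auto
        then show False using code_None[OF p u(1), of "odd v"] empty u(3) by simp
      qed
    qed
  qed
qed

lemma ex_node_of_level:
  assumes p: "closed_rep \<delta> p = Some A" and "\<xi> \<in> A"
  shows "\<exists>v. 2 ^ n \<le> v \<and> v < 2 ^ Suc n \<and> \<xi> \<in> part p A v"
proof (induction n)
  case 0
  show ?case using part_1[OF p] assms(2) by (intro exI[of _ 1]) simp
next
  case (Suc n)
  then obtain v where v: "2 ^ n \<le> v" "v < 2 ^ Suc n" "\<xi> \<in> part p A v" by blast
  have "v \<ge> 1" using v(1) one_le_power[of "2::nat" n] by linarith
  from part_union[OF p this] v(3) obtain w where "w = 2 * v \<or> w = 2 * v + 1" "\<xi> \<in> part p A w" by auto
  with v show ?case by (intro exI[of _ w]) auto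
qed

lemma removed_task:
  assumes "2 ^ Suc n \<le> v" "v < 2 ^ Suc (Suc n)" "e \<in> set_decode (task (odd v) n)"
  shows "removed M v e"
proof -
  have "level (v div 2) = n" using assms(1,2) by (intro level_eq) auto
  moreover have "2 \<le> v" using assms(1) one_le_power[of "2::nat" n] unfolding power_Suc by linarith
  ultimately show ?thesis using assms(3) by (subst removed_iff) (simp add: removed_at_def)
qed

text \<open>Each valid pair is seen to be valid at some stage, and the triple with that stage is
  itself a level.\<close>

lemma ex_task:
  assumes "valid c d"
  shows "\<exists>n. task True n = c \<and> task False n = d"
proof -
  from eventually_valid_at[OF assms] obtain k where "valid_at c d k"
    by (auto simp: eventually_sequentially)
  then show ?thesis by (intro exI[of _ "prod_encode (c, prod_encode (d, k))"]) (simp add: task_def)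
qed

text \<open>Points of \<open>A\<close> stay in nonempty parts. A point outside \<open>A\<close> has
  a neighbourhood \<open>e\<close> separated from each set of a finite cover \<open>d\<close> of
  \<open>A\<close>. The task consisting of the singleton of \<open>e\<close> and of \<open>d\<close>
  excludes the point: right children remove \<open>e\<close>, and left children have an empty
  part.\<close>

lemma decode_code:
  assumes p: "closed_rep \<delta> p = Some A"
  shows "decode (code p) = A"
proof (cases "A = {}")
  case True
  then have "code p 0 \<noteq> None" using code_0[OF p] by blast
  then show ?thesis using True by (auto simp: decode_def killed_def)
next
  case False
  show ?thesis
  proof (intro equalityI subsetI)
    fix \<xi> assume \<xi>: "\<xi> \<in> A"
    have "\<exists>v. 2 ^ n \<le> v \<and> v < 2 ^ Suc n \<and> \<not> killed (code p) v \<and> (\<forall>e. removed {} v e \<longrightarrow> \<xi> \<notin> basic e)" for n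
    proof -
      obtain v where v: "2 ^ n \<le> v" "v < 2 ^ Suc n" "\<xi> \<in> part p A v"
        using ex_node_of_level[OF p \<xi>] by blast
      have "v \<ge> 1" using v(1) one_le_power[of "2::nat" n] by linarith
      then have "\<not> killed (code p) v" using killed_code_iff[OF p False] v(3) by blast
      moreover have "\<xi> \<notin> basic e" if "removed {} v e" for e
        using v(3) removed_mono[OF that empty_subsetI] by (auto simp: part_def)
      ultimately show ?thesis using v(1,2) by blast
    qed
    then show "\<xi> \<in> decode (code p)" using \<xi> A_subset[OF p] by (auto simp: decode_def)
  next
    fix \<xi> assume \<xi>: "\<xi> \<in> decode (code p)"
    show "\<xi> \<in> A"
    proof (rule ccontr)
      assume nA: "\<xi> \<notin> A"
      have "A \<subseteq> (\<Union>f \<in> {f. \<exists>e. \<xi> \<in> basic e \<and> separated e f}. basic f)"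
      proof
        fix \<eta> assume "\<eta> \<in> A"
        then have "\<eta> \<in> ran \<delta>" "\<xi> \<in> ran \<delta>" "\<xi> \<noteq> \<eta>"
          using A_subset[OF p] \<xi> nA by (auto simp: decode_def)
        then show "\<eta> \<in> (\<Union>f \<in> {f. \<exists>e. \<xi> \<in> basic e \<and> separated e f}. basic f)"
          using ex_separated_points by blast
      qed
      from finite_subcover[OF p this] obtain d where
        d: "\<forall>f \<in> set_decode d. \<exists>e. \<xi> \<in> basic e \<and> separated e f" "A \<subseteq> basic_union d" by blast
      then obtain F where F: "\<And>f. f \<in> set_decode d \<Longrightarrow> \<xi> \<in> basic (F f) \<and> separated (F f) f" by metis
      \<comment> \<open>One neighbourhood for all members of \<open>d\<close>: the intersection of
        the finitely many individual ones.\<close>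
      define e where "e = set_encode (\<Union>f \<in> set_decode d. set_decode (F f))"
      have e: "set_decode e = (\<Union>f \<in> set_decode d. set_decode (F f))" by (simp add: e_def)
      have "\<xi> \<in> basic e" using F \<xi> unfolding basic_def decode_def e by auto
      have "separated e f" if "f \<in> set_decode d" for f
        using separated_mono[of "F f" f e] F[OF that] that e by blast
      then have "valid (2 ^ e) d" by (simp add: valid_def)
      then obtain n where n: "task True n = 2 ^ e" "task False n = d" using ex_task by blast
      \<comment> \<open>The task of level \<open>n\<close> acts on the edges into level
        \<open>n + 1\<close>, so a node there is examined.\<close>
      from \<xi> obtain v where v: "2 ^ Suc n \<le> v" "v < 2 ^ Suc (Suc n)" "\<not> killed (code p) v"
        "\<forall>e. removed {} v e \<longrightarrow> \<xi> \<notin> basic e" unfolding decode_def by blast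
      show False
      proof (cases "odd v")
        case True
        then have "removed {} v e" using removed_task[OF v(1,2), of e "{}"] n(1) by simp
        with v(4) \<open>\<xi> \<in> basic e\<close> show False by blast
      next
        case even: False
        have "part p A v = {}"
        proof -
          have "removed (accepted p) v f" if "f \<in> set_decode d" for f
            using removed_task[OF v(1,2), of f] n(2) even that by simp
          then show ?thesis using d(2) unfolding part_def basic_union_def by blast
        qed
        moreover have "v \<ge> 1" using v(1) one_le_power[of "2::nat" "Suc n"] by linarith
        ultimately show False using killed_code_iff[OF p False] v(3) by blast
      qed
    qed
  qed
qed

text \<open>A task made of separated neighbourhoods of the two points occurs at some level; below it
  no part contains both, and parts shrink along branches.\<close>

lemma eventually_part_separates:
  assumes p: "closed_rep \<delta> p = Some A" and "\<xi> \<in> A" "\<eta> \<in> A" "\<xi> \<noteq> \<eta>"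
  shows "\<forall>\<^sub>F v in sequentially. \<not> (\<xi> \<in> part p A v \<and> \<eta> \<in> part p A v)"
proof -
  obtain e f where ef: "\<xi> \<in> basic e" "\<eta> \<in> basic f" "separated e f"
    using ex_separated_points assms A_subset[OF p] by blast
  then have "valid (2 ^ e) (2 ^ f)" by (simp add: valid_def)
  then obtain n where n: "task True n = 2 ^ e" "task False n = 2 ^ f" using ex_task by blast
  have "\<not> (\<xi> \<in> part p A v \<and> \<eta> \<in> part p A v)" if "v \<ge> 2 ^ Suc n" for v
    using that
  proof (induction v rule: less_induct)
    case (less v)
    show ?case
    proof (cases "v < 2 ^ Suc (Suc n)")
      case True
      then have "removed (accepted p) v (if odd v then e else f)"
        using removed_task[OF less(2) True] n by simp
      then show ?thesis using ef unfolding part_def by (cases "odd v") auto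
    next
      case False
      have "v \<ge> 2" using less(2) one_le_power[of "2::nat" n] unfolding power_Suc by linarith
      moreover have "2 ^ Suc n \<le> v div 2" using False by simp
      moreover have "v div 2 < v" using \<open>v \<ge> 2\<close> by simp
      ultimately show ?thesis using less(1) part_mono[OF p] by blast
    qed
  qed
  then show ?thesis by (auto simp: eventually_sequentially)
qed

text \<open>At positions \<open>v \<ge> 1\<close> the value \<bottom> marks the branching nodes,
  which number one less than \<open>A\<close> if \<open>A\<close> is nonempty; position 0 supplies
  the missing one. If \<open>A\<close> is empty, every position receives a report.\<close>

lemma card_code_None:
  assumes p: "closed_rep \<delta> p = Some A" and fin: "finite A"
  shows "finite {v. code p v = None} \<and> card {v. code p v = None} = card A"
proof (cases "A = {}")
  case True
  have "code p v \<noteq> None" for v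
  proof (cases "v = 0")
    case False
    have "part p A (2 * v + of_bool b) = {}" for b using True by (simp add: part_def)
    with False code_None[OF p, of v] show ?thesis by (metis One_nat_def Suc_leI not_gr_zero)
  qed (use code_0[OF p] True in blast)
  then have "{v. code p v = None} = {}" by blast
  then show ?thesis unfolding True by (simp only: finite.emptyI card.empty simp_thms)
next
  case False
  define Br where "Br = {u. u \<ge> 1 \<and> part p A (2 * u) \<noteq> {} \<and> part p A (2 * u + 1) \<noteq> {}}"
  have "\<forall>\<^sub>F v in sequentially. \<forall>\<xi> \<in> A. \<forall>\<eta> \<in> A. \<xi> \<noteq> \<eta> \<longrightarrow> \<not> (\<xi> \<in> part p A v \<and> \<eta> \<in> part p A v)"
  proof (intro eventually_ball_finite fin ballI)
    fix \<xi> \<eta> assume "\<xi> \<in> A" "\<eta> \<in> A"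
    then show "\<forall>\<^sub>F v in sequentially. \<xi> \<noteq> \<eta> \<longrightarrow> \<not> (\<xi> \<in> part p A v \<and> \<eta> \<in> part p A v)"
      using eventually_part_separates[OF p, of \<xi> \<eta>] by (cases "\<xi> = \<eta>") simp_all
  qed
  then obtain M where "\<And>v. v \<ge> M \<Longrightarrow>
      \<forall>\<xi> \<in> A. \<forall>\<eta> \<in> A. \<xi> \<noteq> \<eta> \<longrightarrow> \<not> (\<xi> \<in> part p A v \<and> \<eta> \<in> part p A v)"
    unfolding eventually_sequentially by blast
  moreover have sub: "part p A v \<subseteq> A" for v by (auto simp: part_def)
  ultimately have M: "\<forall>\<xi> \<in> part p A v. \<forall>\<eta> \<in> part p A v. \<xi> = \<eta>" if "v \<ge> M" for v
    using that by blast
  have le1: "card (part p A v) \<le> 1" if "v \<ge> M" for v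
    using M[OF that] card_le_Suc0_iff_eq[OF finite_subset[OF sub fin], of v] by simp
  have "finite Br \<and> Suc (card Br) = card (part p A 1)"
    unfolding Br_def
  proof (rule card_branching_nodes[where M = M])
    show "finite (part p A 1)" "part p A 1 \<noteq> {}" unfolding part_1[OF p] using fin False by blast+
  qed (fact part_union[OF p] part_disjoint[OF p fin] le1)+
  then have Br: "finite Br" "Suc (card Br) = card A" unfolding part_1[OF p] by blast+
  have "code p v = None \<longleftrightarrow> v = 0 \<or> v \<in> Br" for v
  proof (cases "v = 0")
    case False
    then have "v \<ge> 1" by simp
    from code_None[OF p this, of True] code_None[OF p this, of False]
      code_Some[OF p this, of True] code_Some[OF p this, of False]
    show ?thesis using False by (cases "code p v") (auto simp: Br_def)
  qed (use code_0[OF p] \<open>A \<noteq> {}\<close> in simp)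
  then have "{v. code p v = None} = insert 0 Br" by auto
  moreover have "0 \<notin> Br" by (simp add: Br_def)
  ultimately show ?thesis using Br by simp
qed

section \<open>Computability of the decoding map\<close>

definition killed_at :: "cantor \<Rightarrow> nat \<Rightarrow> nat \<Rightarrow> bool" where
  "killed_at p k v \<longleftrightarrow> (\<exists>j<k. p (prod_encode (0, j))) \<or>
     (\<exists>i\<le>v. 2 \<le> v div 2 ^ i \<and> (\<exists>j<k. p (prod_encode (v div 2 ^ i div 2, j)) \<and>
        (\<forall>j'<j. \<not> p (prod_encode (v div 2 ^ i div 2, j'))) \<and> odd j = odd (v div 2 ^ i)))"

text \<open>Here \<open>i = \<langle>n, k\<rangle>\<close> consists of a level \<open>n\<close> of the tree and a number \<open>k\<close> of stages.\<close>

definition discarded :: "cantor \<Rightarrow> nat \<Rightarrow> nat \<Rightarrow> bool" where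
  "discarded p e i \<longleftrightarrow> (\<forall>v<2 ^ Suc (pfst i). 2 ^ pfst i \<le> v \<longrightarrow> killed_at p (psnd i) v \<or>
     (\<exists>f\<le>e. removed {} v f \<and> (\<forall>m \<in> set_decode f. m \<in> set_decode e)))"

lemma killed_iff_killed_at:
  assumes "plotkin_seq_rep p = Some q"
  shows "killed q v \<longleftrightarrow> (\<exists>k. killed_at p k v)"
proof -
  have q: "q n = (if \<exists>k. p (prod_encode (n, k)) then Some (odd (LEAST k. p (prod_encode (n, k)))) else None)" for n
    using assms by (simp add: plotkin_seq_rep_eq fun_eq_iff)
  have 0: "q 0 \<noteq> None \<longleftrightarrow> (\<exists>k. \<exists>j<k. p (prod_encode (0, j)))"
    unfolding q by auto
  have "q n = Some b \<longleftrightarrow> (\<exists>j. p (prod_encode (n, j)) \<and> (\<forall>j'<j. \<not> p (prod_encode (n, j'))) \<and> odd j = b)" for n b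
  proof
    assume "q n = Some b"
    then have ex: "\<exists>j. p (prod_encode (n, j))" and "odd (LEAST j. p (prod_encode (n, j))) = b"
      unfolding q by (auto split: if_splits)
    with LeastI_ex[OF ex] not_less_Least[of _ "\<lambda>j. p (prod_encode (n, j))"]
    show "\<exists>j. p (prod_encode (n, j)) \<and> (\<forall>j'<j. \<not> p (prod_encode (n, j'))) \<and> odd j = b"
      by (intro exI[of _ "LEAST j. p (prod_encode (n, j))"] conjI allI impI)
  next
    assume "\<exists>j. p (prod_encode (n, j)) \<and> (\<forall>j'<j. \<not> p (prod_encode (n, j'))) \<and> odd j = b"
    then obtain j where j: "p (prod_encode (n, j))" "\<forall>j'<j. \<not> p (prod_encode (n, j'))" "odd j = b" by blast
    then have "(LEAST j. p (prod_encode (n, j))) = j" by (intro Least_equality) (auto intro: leI)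
    with j show "q n = Some b" unfolding q by auto
  qed
  then have 1: "q n = Some b \<longleftrightarrow> (\<exists>k. \<exists>j<k. p (prod_encode (n, j)) \<and> (\<forall>j'<j. \<not> p (prod_encode (n, j'))) \<and> odd j = b)" for n b
    by auto
  show ?thesis unfolding killed_def killed_at_def 0 1 by blast
qed

lemma killed_at_mono: "killed_at p k v \<Longrightarrow> k \<le> k' \<Longrightarrow> killed_at p k' v"
  unfolding killed_at_def by (meson order_less_le_trans)

text \<open>A point outside \<open>decode q\<close> fails already at one level, which has finitely
  many nodes. Intersecting the removed sets that contain it at the surviving nodes gives a discarded
  neighbourhood; a larger index set means a smaller basic set.\<close>

lemma mem_decode_iff:
  assumes "plotkin_seq_rep p = Some q"
  shows "\<xi> \<in> decode q \<longleftrightarrow> \<xi> \<in> ran \<delta> \<and> \<not> (\<exists>e i. discarded p e i \<and> \<xi> \<in> basic e)"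
proof (intro iffI conjI notI)
  assume \<xi>: "\<xi> \<in> decode q"
  then show "\<xi> \<in> ran \<delta>" by (simp add: decode_def)
  assume "\<exists>e i. discarded p e i \<and> \<xi> \<in> basic e"
  then obtain e i where ei: "discarded p e i" "\<xi> \<in> basic e" by blast
  from \<xi> obtain v where v: "2 ^ pfst i \<le> v" "v < 2 ^ Suc (pfst i)" "\<not> killed q v"
    "\<forall>e. removed {} v e \<longrightarrow> \<xi> \<notin> basic e" unfolding decode_def by blast
  have "\<not> killed_at p (psnd i) v" using v(3) killed_iff_killed_at[OF assms] by blast
  with ei(1) v(1,2) obtain f where "removed {} v f" "\<forall>m \<in> set_decode f. m \<in> set_decode e"
    unfolding discarded_def by blast
  moreover from this ei(2) have "\<xi> \<in> basic f" by (auto simp: basic_def)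
  ultimately show False using v(4) by blast
next
  assume \<xi>: "\<xi> \<in> ran \<delta> \<and> \<not> (\<exists>e i. discarded p e i \<and> \<xi> \<in> basic e)"
  show "\<xi> \<in> decode q"
  proof (rule ccontr)
    assume "\<xi> \<notin> decode q"
    then obtain n where n: "\<And>v. 2 ^ n \<le> v \<Longrightarrow> v < 2 ^ Suc n \<Longrightarrow> killed q v \<or> (\<exists>e. removed {} v e \<and> \<xi> \<in> basic e)"
      using \<xi> unfolding decode_def by blast
    define V where "V = {v. 2 ^ n \<le> v \<and> v < 2 ^ Suc n \<and> \<not> killed q v}"
    have finV: "finite V" unfolding V_def by (rule finite_subset[of _ "{..<2 ^ Suc n}"]) auto
    have "\<forall>v \<in> V. \<exists>f. removed {} v f \<and> \<xi> \<in> basic f" using n unfolding V_def by blast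
    then obtain F where F: "\<And>v. v \<in> V \<Longrightarrow> removed {} v (F v) \<and> \<xi> \<in> basic (F v)" by metis
    define e where "e = set_encode (\<Union>v \<in> V. set_decode (F v))"
    have e: "set_decode e = (\<Union>v \<in> V. set_decode (F v))" by (simp add: e_def finV)
    have "\<xi> \<in> basic e" using F \<xi> unfolding basic_def e by auto
    have "\<forall>\<^sub>F k in sequentially. \<forall>v \<in> {v \<in> {..<2 ^ Suc n}. killed q v}. killed_at p k v"
    proof (intro eventually_ball_finite ballI)
      fix v assume "v \<in> {v \<in> {..<2 ^ Suc n}. killed q v}"
      then obtain k where "killed_at p k v" using killed_iff_killed_at[OF assms] by blast
      then show "\<forall>\<^sub>F k in sequentially. killed_at p k v"
        unfolding eventually_sequentially using killed_at_mono by blast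
    qed simp
    then obtain k where k: "\<And>v. v < 2 ^ Suc n \<Longrightarrow> killed q v \<Longrightarrow> killed_at p k v"
      by (auto simp: eventually_sequentially)
    have "discarded p e (prod_encode (n, k))"
      unfolding discarded_def
    proof (intro allI impI)
      fix v :: nat assume v: "v < 2 ^ Suc (pfst (prod_encode (n, k)))" "2 ^ pfst (prod_encode (n, k)) \<le> v"
      show "killed_at p (psnd (prod_encode (n, k))) v \<or>
          (\<exists>f\<le>e. removed {} v f \<and> (\<forall>m \<in> set_decode f. m \<in> set_decode e))"
      proof (cases "killed q v")
        case True
        with k v show ?thesis by simp
      next
        case False
        then have "v \<in> V" using v by (simp add: V_def)
        then have "set_decode (F v) \<subseteq> set_decode e" using e by blast
        with F[OF \<open>v \<in> V\<close>] subset_decode_imp_le[OF this] show ?thesis by blast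
      qed
    qed
    with \<xi> \<open>\<xi> \<in> basic e\<close> show False by blast
  qed
qed

lemma decidable_discarded:
  "decidable (\<lambda>p m. discarded p (pfst (psnd m)) (psnd (psnd m)))"
proof -
  \<comment> \<open>The empty set of items is written as \<open>set_decode 0\<close> to fit the
    general decidability result.\<close>
  have "decidable (\<lambda>p n. removed (set_decode 0) (a p n) (b p n))"
    if "total_recursive a" "total_recursive b" for a b
    by (intro recursive_intros that)
  then have [recursive_intros]: "total_recursive a \<Longrightarrow> total_recursive b \<Longrightarrow>
      decidable (\<lambda>p n. removed {} (a p n) (b p n))" for a b
    by simp
  show ?thesis unfolding discarded_def killed_at_def by (intro recursive_intros)
qed

section \<open>The computable retraction onto the closed sets\<close>

theorem closed_sets_retract:
  "\<exists>(t :: (nat \<Rightarrow> bool option) \<Rightarrow> 'a set) (s :: 'a set \<Rightarrow> (nat \<Rightarrow> bool option) set).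
    range t = ran (closed_rep \<delta>) \<and>
    computable_mv (closed_rep \<delta>) plotkin_seq_rep s \<and>
    computable_map plotkin_seq_rep (closed_rep \<delta>) t \<and>
    (\<forall>A \<in> ran (closed_rep \<delta>). t ` s A = {A}) \<and>
    (\<forall>A \<in> ran (closed_rep \<delta>). finite A \<longrightarrow>
       (\<forall>p \<in> s A. finite {n. p n = None} \<and> card {n. p n = None} = card A))"
proof -
  \<comment> \<open>Different names of one set may have different codes, whence the
    multivaluedness.\<close>
  define s where "s A = {code p | p. closed_rep \<delta> p = Some A}" for A
  \<comment> \<open>Removing the discarded basic sets from the whole space yields a name of the
    decoded set, hence a realizer of \<open>decode\<close>.\<close>
  have name: "closed_rep \<delta> (diff_name full_name (discarded p)) = Some (decode q)"
    if "plotkin_seq_rep p = Some q" for p q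
  proof -
    have "{\<xi> \<in> ran \<delta>. \<not> (\<exists>e i. discarded p e i \<and> \<xi> \<in> basic e)} = decode q"
      using mem_decode_iff[OF that] by blast
    then show ?thesis using closed_rep_diff_name[OF closed_rep_full_name, of "discarded p"] by simp
  qed
  have "decidable (\<lambda>p n. diff_name full_name (discarded p) n)"
    by (intro decidable_diff_name[where Q = "\<lambda>p n. full_name" and R = "\<lambda>p n. discarded p"]
        decidable_discarded, unfold full_name_def) (intro recursive_intros)+
  from computable_cantor_decidable[OF this]
  have t: "computable_map plotkin_seq_rep (closed_rep \<delta>) decode"
    unfolding computable_map_def computable_mv_def
    by (intro exI conjI) (auto simp: realizes_def name)
  have s: "computable_mv (closed_rep \<delta>) plotkin_seq_rep s"
    unfolding computable_mv_def
  proof (intro exI conjI)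
    show "computable_cantor (\<lambda>p. Some (out p))" by (rule computable_cantor_decidable[OF decidable_out])
    have "plotkin_seq_rep (out p) = Some (code p)" for p
      unfolding plotkin_seq_rep_eq code_def ..
    then show "realizes (closed_rep \<delta>) plotkin_seq_rep (\<lambda>p. Some (out p)) s"
      unfolding realizes_def s_def by blast
  qed
  have ts: "decode ` s A = {A}" if "A \<in> ran (closed_rep \<delta>)" for A
  proof -
    from that obtain p where "closed_rep \<delta> p = Some A" by (auto simp: ran_def)
    then have "code p \<in> s A" by (auto simp: s_def)
    moreover have "decode q = A" if "q \<in> s A" for q using that decode_code by (auto simp: s_def)
    ultimately show ?thesis by blast
  qed
  have range: "range decode = ran (closed_rep \<delta>)"
  proof (intro equalityI subsetI)
    fix A assume "A \<in> range decode"
    then obtain q where q: "A = decode q" by blast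
    \<comment> \<open>Every sequence has a name: a single report of parity \<open>b\<close> at an
      entry \<open>Some b\<close>, none at \<bottom>.\<close>
    define p where "p = (\<lambda>m. case q (pfst m) of None \<Rightarrow> False | Some b \<Rightarrow> psnd m = of_bool b)"
    have least: "(LEAST k. k = of_bool b) = (of_bool b :: nat)" for b
      by (rule Least_equality) simp_all
    have "(if \<exists>k. p (prod_encode (n, k)) then Some (odd (LEAST k. p (prod_encode (n, k)))) else None) = q n"
      for n
    proof (cases "q n")
      case (Some b)
      then have "p (prod_encode (n, k)) \<longleftrightarrow> k = of_bool b" for k by (simp add: p_def)
      then show ?thesis using Some least[of b] by (simp only:) simp
    qed (simp add: p_def)
    then have "plotkin_seq_rep p = Some q" by (simp only: plotkin_seq_rep_eq)
    from name[OF this] q show "A \<in> ran (closed_rep \<delta>)" by (auto intro: ranI)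
  next
    fix A assume "A \<in> ran (closed_rep \<delta>)"
    from ts[OF this] show "A \<in> range decode" by blast
  qed
  have bottoms: "finite {n. q n = None} \<and> card {n. q n = None} = card A"
    if "q \<in> s A" "finite A" for q A
    using that card_code_None unfolding s_def by blast
  show ?thesis
    by (intro exI[of _ decode] exI[of _ s] conjI ballI impI range s t)
      (fact ts | metis bottoms)+
qed

end

section \<open>Proper dyadic subbases of compact Hausdorff spaces\<close>

definition subbase_set :: "(nat \<Rightarrow> bool \<Rightarrow> 'a set) \<Rightarrow> nat \<Rightarrow> 'a set" where
  "subbase_set S m = S (m div 2) (odd m)"

lemma subbase_set_double [simp]: "subbase_set S (2 * k + of_bool b) = S k b"
  by (simp add: subbase_set_def)

lemma subbase_set_flip: "subbase_set S (flip m) = S (m div 2) (even m)"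
  by (auto simp: subbase_set_def flip_def elim!: oddE)

section \<open>Verifying membership in the sets of a dyadic subbase\<close>

lemma computable_mapE:
  assumes "computable_map \<delta>X \<delta>Y f"
  obtains \<Phi> where "partial_recursive \<Phi>"
    "\<And>p x. \<delta>X p = Some x \<Longrightarrow> \<exists>q. (\<forall>n. \<Phi> p n = Some (of_bool (q n))) \<and> \<delta>Y q = Some (f x)"
proof -
  from assms obtain F where F: "computable_cantor F" "realizes \<delta>X \<delta>Y F (\<lambda>x. {f x})"
    by (auto simp: computable_map_def computable_mv_def)
  from F(1) obtain \<Phi> where \<Phi>: "partial_recursive \<Phi>"
    "\<And>p. F p = the_opt (\<lambda>q. \<forall>n. \<Phi> p n = Some (of_bool (q n)))"
    unfolding computable_cantor_def by blast
  have "\<exists>q. (\<forall>n. \<Phi> p n = Some (of_bool (q n))) \<and> \<delta>Y q = Some (f x)" if x: "\<delta>X p = Some x" for p x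
  proof -
    from F(2) x obtain q where "F p = Some q" "\<delta>Y q = Some (f x)"
      unfolding realizes_def by blast
    then show ?thesis unfolding \<Phi>(2) the_opt_eq_Some_iff by blast
  qed
  with \<Phi>(1) show thesis by (rule that)
qed

text \<open>A realizer of the coding of points computes a name over Plotkin's domain. The parity of
  its first 1 tells which set of the pair holds the point; approximating the search for that 1 in
  stages gives \<open>ver\<close>.\<close>

lemma ex_effective_subbase:
  assumes comp: "computable_map \<delta> plotkin_seq_rep (subbase_code S)"
    and disj: "\<And>n. S n False \<inter> S n True = {}"
  shows "\<exists>ver. effective_subbase \<delta> (subbase_set S) ver"
proof -
  from computable_mapE[OF comp] obtain \<Phi> where \<Phi>: "partial_recursive \<Phi>"
    "\<And>p x. \<delta> p = Some x \<Longrightarrow>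
       \<exists>q. (\<forall>n. \<Phi> p n = Some (of_bool (q n))) \<and> plotkin_seq_rep q = Some (subbase_code S x)" by blast
  \<comment> \<open>The output bits are complemented because minimization looks for a zero.\<close>
  define F where "F = (\<lambda>p n. Option.bind (\<Phi> p n) (\<lambda>v. Some (1 - v)))"
  define \<Psi> where "\<Psi> = (\<lambda>p n.
      if \<exists>k. F p (prod_encode (n, k)) = Some 0 \<and> (\<forall>j<k. F p (prod_encode (n, j)) \<noteq> None)
      then Some (LEAST k. F p (prod_encode (n, k)) = Some 0)
      else None)"
  have "total_recursive (\<lambda>p n. 1 - n)" by (intro recursive_intros)
  then have "partial_recursive F"
    unfolding F_def total_recursive_def by (rule partial_recursive.comp[OF _ \<Phi>(1)])
  then have "partial_recursive \<Psi>" unfolding \<Psi>_def by (rule partial_recursive.mu)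
  then obtain T where T: "approximates T \<Psi>" using partial_recursive_approximable by blast
  \<comment> \<open>\<open>T\<close> returns the successor of the position found, so an even value
    means an odd position, that is, the set with index \<open>True\<close>.\<close>
  define ver where "ver p s m \<longleftrightarrow> T p s (m div 2) \<noteq> 0 \<and> even (T p s (m div 2)) = odd m" for p s m
  have "effective_subbase \<delta> (subbase_set S) ver"
  proof
    show "decidable (\<lambda>p m. ver p (pfst m) (psnd m))"
      unfolding ver_def by (intro recursive_intros approximatesD(1)[OF T])
    show "ver p s m = ver p' s m" if "\<And>i. i < s \<Longrightarrow> p i = p' i" for s p p' m
      using approximatesD(4)[OF T that] by (simp add: ver_def)
    show "ver p s' m" if "ver p s m" "s \<le> s'" for p s m s'
    proof -
      from that(1) obtain k where "T p s (m div 2) = Suc k"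
        unfolding ver_def by (meson not0_implies_Suc)
      moreover from approximatesD(3)[OF T this that(2)] have "T p s' (m div 2) = Suc k" .
      ultimately show ?thesis using that(1) by (simp add: ver_def)
    qed
    show "\<xi> \<in> subbase_set S m \<longleftrightarrow> (\<exists>s. ver x s m)" if x: "\<delta> x = Some \<xi>" for x \<xi> m
    proof -
      from \<Phi>(2)[OF x] obtain q where q: "\<And>n. \<Phi> x n = Some (of_bool (q n))"
        "plotkin_seq_rep q = Some (subbase_code S \<xi>)" by blast
      have F: "F x n = Some 0 \<longleftrightarrow> q n" "F x n \<noteq> None" for n by (simp_all add: F_def q(1))
      have \<Psi>: "\<Psi> x n = (if \<exists>k. q (prod_encode (n, k)) then Some (LEAST k. q (prod_encode (n, k))) else None)" for n
        unfolding \<Psi>_def F(1) using F(2) by simp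
      have "subbase_code S \<xi> = (\<lambda>n. if \<exists>k. q (prod_encode (n, k))
          then Some (odd (LEAST k. q (prod_encode (n, k)))) else None)"
        using q(2) unfolding plotkin_seq_rep_eq by simp
      then have "subbase_code S \<xi> n = map_option odd (\<Psi> x n)" for n
        unfolding \<Psi> by simp
      moreover have "\<xi> \<in> S n b \<longleftrightarrow> subbase_code S \<xi> n = Some b" for n b
        using disj[of n] by (cases b) (auto simp: subbase_code_def)
      ultimately have "\<xi> \<in> subbase_set S m \<longleftrightarrow> (\<exists>k. \<Psi> x (m div 2) = Some k \<and> odd k = odd m)"
        by (auto simp: subbase_set_def)
      also have "\<dots> \<longleftrightarrow> (\<exists>s k. T x s (m div 2) = Suc k \<and> odd k = odd m)"
        unfolding approximatesD(2)[OF T] by blast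
      also have "\<dots> \<longleftrightarrow> (\<exists>s. ver x s m)"
      proof -
        have "(\<exists>k. i = Suc k \<and> odd k = odd m) \<longleftrightarrow> i \<noteq> 0 \<and> even i = odd m" for i
          by (cases i) auto
        then show ?thesis by (simp only: ver_def)
      qed
      finally show ?thesis .
    qed
  qed
  then show ?thesis by blast
qed

section \<open>Topological separation by basic sets\<close>

context effectively_compact_subbase
begin

lemma ex_basic_subset:
  assumes top: "rep_topology \<delta> = topology (arbitrary union_of
       (finite intersection_of (\<lambda>U. \<exists>n i. U = S n i) relative_to ran \<delta>))"
    and B: "B = subbase_set S"
    and "openin (rep_topology \<delta>) U" "\<xi> \<in> U"
  shows "\<exists>e. \<xi> \<in> basic e \<and> basic e \<subseteq> U"
proof -
  let ?Q = "finite intersection_of (\<lambda>U. \<exists>n i. U = S n i) relative_to ran \<delta>"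
  have "(arbitrary union_of ?Q) U" using assms(3) unfolding top openin_subbase .
  then obtain \<U> where \<U>: "\<U> \<subseteq> Collect ?Q" "\<Union>\<U> = U" unfolding union_of_def by (elim exE conjE)
  from assms(4) obtain V where V: "V \<in> \<U>" "\<xi> \<in> V" unfolding \<U>(2)[symmetric] ..
  then have "V \<subseteq> U" using \<U>(2) by blast
  have "?Q V" using subsetD[OF \<U>(1) V(1)] by (rule CollectD)
  then obtain T where T: "(finite intersection_of (\<lambda>U. \<exists>n i. U = S n i)) T" "ran \<delta> \<inter> T = V"
    unfolding relative_to_def by (elim exE conjE)
  from T(1) obtain \<F> where \<F>: "finite \<F>" "\<F> \<subseteq> {U. \<exists>n i. U = S n i}" "\<Inter>\<F> = T"
    unfolding intersection_of_def by (elim exE conjE)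
  have "\<forall>W \<in> \<F>. \<exists>m. W = B m"
  proof
    fix W assume "W \<in> \<F>"
    then obtain n i where "W = S n i" using \<F>(2) by blast
    then have "W = B (2 * n + of_bool i)" unfolding B by simp
    then show "\<exists>m. W = B m" ..
  qed
  then obtain f where f: "\<And>W. W \<in> \<F> \<Longrightarrow> W = B (f W)" by metis
  have "basic (set_encode (f ` \<F>)) = V"
    using \<F>(1) f unfolding T(2)[symmetric] \<F>(3)[symmetric] by (auto simp: basic_def)
  with V(2) \<open>V \<subseteq> U\<close> show ?thesis by blast
qed

text \<open>Finite subcovers by basic sets, available for the closed set
  \<open>ran \<delta>\<close>, refine an arbitrary open cover.\<close>

lemma compact_space_rep_topology:
  assumes "\<And>U \<xi>. openin (rep_topology \<delta>) U \<Longrightarrow> \<xi> \<in> U \<Longrightarrow> \<exists>e. \<xi> \<in> basic e \<and> basic e \<subseteq> U"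
    and "topspace (rep_topology \<delta>) = ran \<delta>"
  shows "compact_space (rep_topology \<delta>)"
  unfolding compact_space
proof (intro allI impI)
  fix \<U> assume \<U>: "(\<forall>U\<in>\<U>. openin (rep_topology \<delta>) U) \<and> \<Union>\<U> = topspace (rep_topology \<delta>)"
  let ?E = "{e. \<exists>U \<in> \<U>. basic e \<subseteq> U}"
  have "ran \<delta> \<subseteq> (\<Union>e \<in> ?E. basic e)"
  proof
    fix \<xi> assume "\<xi> \<in> ran \<delta>"
    then obtain U where "U \<in> \<U>" "\<xi> \<in> U" using \<U> assms(2) by blast
    with assms(1)[of U \<xi>] \<U> show "\<xi> \<in> (\<Union>e \<in> ?E. basic e)" by blast
  qed
  from finite_subcover[OF closed_rep_full_name this] obtain l where
    l: "\<forall>e \<in> set_decode l. \<exists>U \<in> \<U>. basic e \<subseteq> U" "ran \<delta> \<subseteq> basic_union l" by blast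
  then obtain f where f: "\<And>e. e \<in> set_decode l \<Longrightarrow> f e \<in> \<U> \<and> basic e \<subseteq> f e" by metis
  have "ran \<delta> \<subseteq> \<Union>(f ` set_decode l)" using l(2) f unfolding basic_union_def by blast
  moreover have "\<Union>(f ` set_decode l) \<subseteq> ran \<delta>" using \<U> assms(2) f by blast
  ultimately show "\<exists>\<F>. finite \<F> \<and> \<F> \<subseteq> \<U> \<and> \<Union>\<F> = topspace (rep_topology \<delta>)"
    using f assms(2) by (intro exI[of _ "f ` set_decode l"]) auto
qed

text \<open>Since \<open>basic f\<close> is inhabited, \<open>f\<close> cannot contain both indices
  of a pair; so it corresponds to a finite sequence over \<bottom>, 0 and 1, to which properness
  applies.\<close>

lemma closure_of_basic:
  assumes proper: "proper_subbase \<delta> S" and B: "B = subbase_set S"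
    and disj: "\<And>n. S n False \<inter> S n True = {}" and ne: "\<xi> \<in> basic f"
  shows "rep_topology \<delta> closure_of basic f = {\<eta> \<in> ran \<delta>. \<forall>m \<in> set_decode f. \<eta> \<notin> B (flip m)}"
proof -
  \<comment> \<open>The length \<open>f\<close> suffices, as all members of the set coded by
    \<open>f\<close> are below \<open>f\<close>.\<close>
  define e where "e = map (\<lambda>k. if 2 * k \<in> set_decode f then Some False
    else if 2 * k + 1 \<in> set_decode f then Some True else None) [0..<f]"
  have cons: "\<not> (2 * k \<in> set_decode f \<and> 2 * k + 1 \<in> set_decode f)" for k
  proof
    assume "2 * k \<in> set_decode f \<and> 2 * k + 1 \<in> set_decode f"
    then have "\<xi> \<in> B (2 * k + of_bool False)" "\<xi> \<in> B (2 * k + of_bool True)"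
      using ne by (simp_all add: basic_def)
    moreover have "B (2 * k + of_bool b) = S k b" for b unfolding B by (rule subbase_set_double)
    ultimately show False using disj[of k] by blast
  qed
  have pad: "pad e k = Some b \<longleftrightarrow> 2 * k + of_bool b \<in> set_decode f" for k b
  proof (cases "k < f")
    case True
    then show ?thesis using cons[of k] by (cases b) (auto simp: pad_def e_def)
  next
    case False
    then have "2 * k + of_bool b \<notin> set_decode f" using less_of_mem_set_decode[of "2 * k + of_bool b" f] by auto
    then show ?thesis using False by (simp add: pad_def e_def)
  qed
  have all: "(\<forall>k \<in> dom (pad e). Q k (the (pad e k))) \<longleftrightarrow> (\<forall>m \<in> set_decode f. Q (m div 2) (odd m))" for Q
  proof (intro iffI ballI)
    fix m assume Q: "\<forall>k \<in> dom (pad e). Q k (the (pad e k))" and m: "m \<in> set_decode f"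
    have "2 * (m div 2) + of_bool (odd m) = m" by simp
    then have "pad e (m div 2) = Some (odd m)" using m unfolding pad by simp
    with Q show "Q (m div 2) (odd m)" by force
  next
    fix k assume Q: "\<forall>m \<in> set_decode f. Q (m div 2) (odd m)" and "k \<in> dom (pad e)"
    then obtain b where "pad e k = Some b" by blast
    moreover from this have "2 * k + of_bool b \<in> set_decode f" unfolding pad .
    ultimately show "Q k (the (pad e k))" using bspec[OF Q, of "2 * k + of_bool b"] by simp
  qed
  have Bm: "B m = S (m div 2) (odd m)" "B (flip m) = S (m div 2) (even m)" for m
    unfolding B subbase_set_flip by (simp_all add: subbase_set_def)
  have "subbase_inter \<delta> S (pad e) = basic f"
    unfolding subbase_inter_def basic_def Bm(1) using all[of "\<lambda>k b. _ \<in> S k b"] by simp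
  moreover have "subbase_bar \<delta> S (pad e) = {\<eta> \<in> ran \<delta>. \<forall>m \<in> set_decode f. \<eta> \<notin> B (flip m)}"
    unfolding subbase_bar_def Bm(2) using all[of "\<lambda>k b. _ \<in> ran \<delta> - S k (\<not> b)"] by auto
  ultimately show ?thesis using proper unfolding proper_subbase_def by metis
qed

text \<open>Compact Hausdorff spaces are regular, so a point has a basic neighbourhood whose closure
  stays in a given open set. By properness, leaving this closure means lying in an opposite subbasic
  set, which is the condition in \<open>separated\<close>.\<close>

lemma separating_subbaseI:
  assumes dyadic: "dyadic_subbase \<delta> S" and B: "B = subbase_set S"
    and proper: "proper_subbase \<delta> S" and Hausdorff: "Hausdorff_space (rep_topology \<delta>)"
  shows "separating_subbase \<delta> B ver K \<Phi>"
proof -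
  have top: "rep_topology \<delta> = topology (arbitrary union_of
       (finite intersection_of (\<lambda>U. \<exists>n i. U = S n i) relative_to ran \<delta>))"
    and disj: "\<And>n. S n False \<inter> S n True = {}"
    using dyadic unfolding dyadic_subbase_def by blast+
  have topspace: "topspace (rep_topology \<delta>) = ran \<delta>"
    unfolding top by (rule topspace_subbase)
  have B_open: "openin (rep_topology \<delta>) (B m)" for m
  proof -
    have "B m \<subseteq> ran \<delta>"
      using dyadic unfolding dyadic_subbase_def B subbase_set_def
      by (auto simp: ran_def open_rep_eq_Some_iff)
    moreover have "\<exists>n i. B m = S n i" unfolding B subbase_set_def by blast
    ultimately show ?thesis
      unfolding top openin_subbase
      by (intro arbitrary_union_of_inc relative_to_subset_inc finite_intersection_of_inc)
  qed
  note basis = ex_basic_subset[OF top B]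
  have "regular_space (rep_topology \<delta>)"
    using compact_Hausdorff_imp_regular_space[OF compact_space_rep_topology[OF basis topspace] Hausdorff]
    by blast
  have shrink: "\<exists>f. \<xi> \<in> basic f \<and> (\<forall>\<eta> \<in> ran \<delta> - U. \<exists>m \<in> set_decode f. \<eta> \<in> B (flip m))"
    if U: "openin (rep_topology \<delta>) U" "\<xi> \<in> U" for U \<xi>
  proof -
    have "closedin (rep_topology \<delta>) (ran \<delta> - U)" "\<xi> \<in> topspace (rep_topology \<delta>) - (ran \<delta> - U)"
      using U openin_subset[OF U(1)] by (auto simp: closedin_def topspace Diff_Diff_Int Int_absorb1)
    with \<open>regular_space (rep_topology \<delta>)\<close> obtain W V where
      W: "openin (rep_topology \<delta>) W" "openin (rep_topology \<delta>) V" "\<xi> \<in> W" "ran \<delta> - U \<subseteq> V" "disjnt W V"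
      unfolding regular_space_def by meson
    from basis[OF W(1,3)] obtain f where f: "\<xi> \<in> basic f" "basic f \<subseteq> W" by blast
    have "rep_topology \<delta> closure_of basic f \<subseteq> ran \<delta> - V"
    proof (rule closure_of_minimal)
      show "basic f \<subseteq> ran \<delta> - V" using f(2) W(5) by (auto simp: basic_def disjnt_iff)
      show "closedin (rep_topology \<delta>) (ran \<delta> - V)"
        using W(2) topspace by (metis closedin_topspace closedin_diff)
    qed
    with W(4) have "\<exists>m \<in> set_decode f. \<eta> \<in> B (flip m)" if "\<eta> \<in> ran \<delta> - U" for \<eta>
      using that unfolding closure_of_basic[OF proper B disj f(1)] by blast
    with f(1) show ?thesis by blast
  qed
  \<comment> \<open>Shrinking inside \<open>B (flip m)\<close>: points of this set are handled by
    \<open>m\<close> from \<open>e\<close>, all others by the neighbourhood's own index set.\<close>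
  have sep_basic: "\<exists>f. \<xi> \<in> basic f \<and> separated f e"
    if "m \<in> set_decode e" "\<xi> \<in> B (flip m)" for \<xi> m e
    using shrink[OF B_open that(2)] that(1) unfolding separated_def by blast
  show ?thesis
  proof
    show "B m \<inter> B (flip m) = {}" for m
    proof -
      have "B m = S (m div 2) (odd m)" "B (flip m) = S (m div 2) (even m)"
        unfolding B subbase_set_flip by (simp_all add: subbase_set_def)
      then show ?thesis using disj[of "m div 2"] by (cases "odd m") auto
    qed
    show "\<exists>f. \<xi> \<in> basic f \<and> separated f e"
      if "\<xi> \<in> ran \<delta>" "m \<in> set_decode e" "\<xi> \<in> B (flip m)" for \<xi> m e
      using sep_basic that(2,3) .
    show "\<exists>e f. \<xi> \<in> basic e \<and> \<eta> \<in> basic f \<and> separated e f"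
      if pts: "\<xi> \<in> ran \<delta>" "\<eta> \<in> ran \<delta>" "\<xi> \<noteq> \<eta>" for \<xi> \<eta>
    proof -
      obtain U V where UV: "openin (rep_topology \<delta>) V" "\<xi> \<in> U" "\<eta> \<in> V" "disjnt U V"
        using Hausdorff pts unfolding Hausdorff_space_def topspace by metis
      \<comment> \<open>The other point avoids \<open>V\<close>, hence lies outside
        \<open>bar S(f)\<close>, and the previous separation applies to it.\<close>
      from shrink[OF UV(1,3)] obtain f where
        f: "\<eta> \<in> basic f" "\<forall>\<eta> \<in> ran \<delta> - V. \<exists>m \<in> set_decode f. \<eta> \<in> B (flip m)" by blast
      have "\<xi> \<in> ran \<delta> - V" using pts(1) UV by (auto simp: disjnt_iff)
      with f(2) obtain m where "m \<in> set_decode f" "\<xi> \<in> B (flip m)" by blast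
      from sep_basic[OF this] f(1) show ?thesis by blast
    qed
  qed
qed

end

text \<open>The coding of points supplies \<open>ver\<close>, the emptiness test supplies
  \<open>K\<close>, and properness with the Hausdorff property supplies separation, so the general
  retraction applies.\<close>

theorem theorem20:
  fixes \<delta> :: "'a rep"
  assumes "computably_compact \<delta>"
    and "Hausdorff_space (rep_topology \<delta>)"
    and "\<exists>S. computable_dyadic_subbase \<delta> S \<and> proper_subbase \<delta> S"
  shows "\<exists>(t :: (nat \<Rightarrow> bool option) \<Rightarrow> 'a set) (s :: 'a set \<Rightarrow> (nat \<Rightarrow> bool option) set).
    range t = ran (closed_rep \<delta>) \<and>
    computable_mv (closed_rep \<delta>) plotkin_seq_rep s \<and>
    computable_map plotkin_seq_rep (closed_rep \<delta>) t \<and>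
    (\<forall>A \<in> ran (closed_rep \<delta>). t ` s A = {A}) \<and>
    (\<forall>A \<in> ran (closed_rep \<delta>). finite A \<longrightarrow>
       (\<forall>p \<in> s A. finite {n. p n = None} \<and> card {n. p n = None} = card A))"
proof -
  from assms(3) obtain S where S: "dyadic_subbase \<delta> S" "proper_subbase \<delta> S"
    "computable_map \<delta> plotkin_seq_rep (subbase_code S)"
    unfolding computable_dyadic_subbase_def by blast
  from S(1) have "S n False \<inter> S n True = {}" for n unfolding dyadic_subbase_def by blast
  from ex_effective_subbase[OF S(3) this] obtain ver
    where ver: "effective_subbase \<delta> (subbase_set S) ver" by blast
  from computable_mapE[OF assms(1)[unfolded computably_compact_def]] obtain \<Phi> where
    \<Phi>: "partial_recursive \<Phi>" "\<And>p A. closed_rep \<delta> p = Some A \<Longrightarrow>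
      \<exists>q. (\<forall>n. \<Phi> p n = Some (of_bool (q n))) \<and> sierpinski_rep q = Some (A = {})" by blast
  from partial_recursive_approximable[OF \<Phi>(1)] obtain K where K: "approximates K \<Phi>" by blast
  have "(\<exists>n. \<Phi> p n = Some 1) \<longleftrightarrow> A = {}" if "closed_rep \<delta> p = Some A" for p A
    using \<Phi>(2)[OF that] by (auto simp: sierpinski_rep_def)
  with ver K have "effectively_compact_subbase \<delta> (subbase_set S) ver K \<Phi>"
    by (simp add: effectively_compact_subbase_def effectively_compact_subbase_axioms_def)
  then have "separating_subbase \<delta> (subbase_set S) ver K \<Phi>"
    by (rule effectively_compact_subbase.separating_subbaseI[OF _ S(1) refl S(2) assms(2)])
  then show ?thesis by (rule separating_subbase.closed_sets_retract)
qed

end
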